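(* Let $d\ge1$, $N\geq 1$, $\frac{d+1}{d}\le r\le\infty$, $T>0$, let $\Omega\subset\mathbb{R}^d$ be a domain and let $u:\Omega\times(0,T)\to\mathbb{R}^N$ be an entropy solution to $\partial_t u+\operatorname{div}F[u]=0$ with entropy $\eta$ and entropy flux $Q$, with $\mathsf{D}\in\mathcal{M}_{\rm loc}(\Omega\times(0,T))$ the corresponding anomalous dissipation measure. Assume that $\eta[u],Q[u]\in L^r_{\rm loc}(\Omega\times(0,T))$. Set $s=d+1-\frac{r}{r-1}$, with the convention that $s=d$ for $r=\infty$. Then, if $r<\infty$, $$\mathcal{H}^s(B)<\infty\ \Rightarrow\ \mathsf{D}(B)=0\qquad\text{for all Borel } B\subset\subset\Omega\times(0,T),$$ while for $r=\infty$ one has $\mathsf{D}\ll\mathcal{H}^d$. In particular, if $\mathsf{D}$ is non-trivial and concentrated on a space-time set $S$, then $$\dim_{\mathcal{H}}S\ge s.$$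
   Context: Setup. $F:\mathbb{R}^N\to\mathbb{R}^{d\times N}$ is a flux, and it is supposed that smooth solutions of $\partial_t u+\operatorname{div}F[u]=0$ (divergence in the space variables) admit a conserved entropy $\eta:\mathbb{R}^N\to\mathbb{R}$ with corresponding entropy flux $Q:\mathbb{R}^N\to\mathbb{R}^d$, i.e. smooth solutions satisfy $\partial_t\eta[u]+\operatorname{div}Q[u]=0$. Put $\mathsf{V}:=(\eta[u],Q[u])$, a space-time vector field on $\Omega\times(0,T)$. An entropy solution is a weak (distributional) solution $u:\Omega\times(0,T)\to\mathbb{R}^N$ of $\partial_tu+\operatorname{div}F[u]=0$ such that $\operatorname{div}_{t,x}\mathsf{V}=\partial_t\eta[u]+\operatorname{div}Q[u]=-\mathsf{D}$ in the sense of distributions on $\Omega\times(0,T)$, where $\mathsf{D}\in\mathcal{M}_{\rm loc}(\Omega\times(0,T))$ is a positive (locally finite) Borel measure, called the anomalous dissipation measure. $\mathcal{H}^s$ is the standard $s$-dimensional Hausdorff measure in space-time $\mathbb{R}^d\times\mathbb{R}=\mathbb{R}^{d+1}$ and $\dim_{\mathcal{H}}$ the Hausdorff dimension. $B\subset\subset\Omega\times(0,T)$ means that the closure of $B$ is compact and contained in $\Omega\times(0,T)$. A measure $\mu$ is concentrated on a (Borel) set $S$ if $\mu(A)=\mu(A\cap S)$ for all measurable $A$. *)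

theory Defs
  imports "HOL-Analysis.Analysis"
begin

text \<open>\<open>C^k\<close> on an open set, through iterated partial derivatives.\<close>

primrec Ck_on ::
  "nat \<Rightarrow> 'a::euclidean_space set \<Rightarrow> ('a \<Rightarrow> 'b::real_normed_vector) \<Rightarrow> bool" where
  "Ck_on 0 G f \<longleftrightarrow> continuous_on G f"
| "Ck_on (Suc k) G f \<longleftrightarrow>
     (\<forall>z\<in>G. f differentiable (at z)) \<and>
     (\<forall>b\<in>Basis. Ck_on k G (\<lambda>z. frechet_derivative f (at z) b))"

definition smooth_on ::
  "'a::euclidean_space set \<Rightarrow> ('a \<Rightarrow> 'b::real_normed_vector) \<Rightarrow> bool" where
  "smooth_on G f \<longleftrightarrow> (\<forall>k. Ck_on k G f)"

definition test_functions :: "'a::euclidean_space set \<Rightarrow> ('a \<Rightarrow> real) set" where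
  "test_functions G =
     {\<phi>. smooth_on UNIV \<phi> \<and> compact (closure {z. \<phi> z \<noteq> 0}) \<and> closure {z. \<phi> z \<noteq> 0} \<subseteq> G}"

definition Lp_loc ::
  "ereal \<Rightarrow> 'a::euclidean_space set \<Rightarrow> ('a \<Rightarrow> 'b::euclidean_space) \<Rightarrow> bool" where
  "Lp_loc r G f \<longleftrightarrow>
     f \<in> borel_measurable (lebesgue_on G) \<and>
     (\<forall>K. compact K \<and> K \<subseteq> G \<longrightarrow>
        (if r = \<infinity> then \<exists>C. AE z in lebesgue_on K. norm (f z) \<le> C
         else integrable (lebesgue_on K) (\<lambda>z. norm (f z) powr real_of_ereal r)))"

definition locally_finite_borel_measure ::
  "'a::euclidean_space set \<Rightarrow> 'a measure \<Rightarrow> bool" where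
  "locally_finite_borel_measure G \<mu> \<longleftrightarrow>
     sets \<mu> = sets (restrict_space borel G) \<and>
     (\<forall>K. compact K \<and> K \<subseteq> G \<longrightarrow> emeasure \<mu> K < \<infinity>)"

definition concentrated_on :: "'a::topological_space measure \<Rightarrow> 'a set \<Rightarrow> bool" where
  "concentrated_on \<mu> S \<longleftrightarrow>
     S \<in> sets borel \<and> (\<forall>A\<in>sets \<mu>. emeasure \<mu> A = emeasure \<mu> (A \<inter> S))"

definition compactly_contained ::
  "'a::topological_space set \<Rightarrow> 'a set \<Rightarrow> bool"  (infix "\<subset>\<subset>" 50) where
  "B \<subset>\<subset> G \<longleftrightarrow> compact (closure B) \<and> closure B \<subseteq> G"

text \<open>
  \<open>div V = L\<close> in the sense of distributions on \<open>G\<close>, where \<open>L\<close> is given by its action on test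
  functions.  The integrand is \<open>V \<bullet> \<nabla>\<phi>\<close>, written as the derivative of \<open>\<phi>\<close> at \<open>z\<close> in direction
  \<open>V z\<close>.
\<close>

definition has_distributional_div ::
  "'a::euclidean_space set \<Rightarrow> ('a \<Rightarrow> 'a) \<Rightarrow> (('a \<Rightarrow> real) \<Rightarrow> real) \<Rightarrow> bool" where
  "has_distributional_div G V L \<longleftrightarrow>
     Lp_loc 1 G V \<and>
     (\<forall>\<phi>\<in>test_functions G.
        - (\<integral>z. frechet_derivative \<phi> (at z) (V z) \<partial>lebesgue_on G) = L \<phi>)"

text \<open>
  Space-time points are pairs \<open>(x, t)\<close>, so that the space-time vector field of a density \<open>h\<close> with
  flux \<open>J\<close> is \<open>(J, h)\<close> and its space-time divergence is \<open>\<partial>\<^sub>t h + div J\<close>.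
\<close>

definition weak_solution ::
  "((real^'d) \<times> real) set \<Rightarrow> (real^'n \<Rightarrow> real^'n^'d) \<Rightarrow>
     ((real^'d) \<times> real \<Rightarrow> real^'n) \<Rightarrow> bool" where
  "weak_solution G F u \<longleftrightarrow>
     (\<forall>i. has_distributional_div G (\<lambda>z. (\<chi> j. F (u z) $ j $ i, u z $ i)) (\<lambda>\<phi>. 0))"

definition entropy_field ::
  "(real^'n \<Rightarrow> real) \<Rightarrow> (real^'n \<Rightarrow> real^'d) \<Rightarrow>
     ((real^'d) \<times> real \<Rightarrow> real^'n) \<Rightarrow> (real^'d) \<times> real \<Rightarrow> (real^'d) \<times> real" where
  "entropy_field \<eta> Q u = (\<lambda>z. (Q (u z), \<eta> (u z)))"

text \<open>
  Both equations are read distributionally also for smooth \<open>v\<close>, since \<open>F\<close>, \<open>\<eta>\<close> and \<open>Q\<close>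
  need not be differentiable.
\<close>

definition entropy_pair ::
  "((real^'d) \<times> real) set \<Rightarrow> (real^'n \<Rightarrow> real^'n^'d) \<Rightarrow>
     (real^'n \<Rightarrow> real) \<Rightarrow> (real^'n \<Rightarrow> real^'d) \<Rightarrow> bool" where
  "entropy_pair G F \<eta> Q \<longleftrightarrow>
     (\<forall>v. smooth_on G v \<and> weak_solution G F v \<longrightarrow>
        has_distributional_div G (entropy_field \<eta> Q v) (\<lambda>\<phi>. 0))"

definition entropy_solution ::
  "((real^'d) \<times> real) set \<Rightarrow> (real^'n \<Rightarrow> real^'n^'d) \<Rightarrow>
     (real^'n \<Rightarrow> real) \<Rightarrow> (real^'n \<Rightarrow> real^'d) \<Rightarrow>
     ((real^'d) \<times> real \<Rightarrow> real^'n) \<Rightarrow> ((real^'d) \<times> real) measure \<Rightarrow> bool" where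
  "entropy_solution G F \<eta> Q u D \<longleftrightarrow>
     weak_solution G F u \<and>
     locally_finite_borel_measure G D \<and>
     has_distributional_div G (entropy_field \<eta> Q u) (\<lambda>\<phi>. - (\<integral>z. \<phi> z \<partial>D))"

text \<open>
  The contribution of a covering set, normalised so that a ball contributes its volume in integer
  dimensions.  The case \<open>s = 0\<close> is separate because \<open>0 powr 0 = 0\<close>, whereas a singleton has to
  count \<open>1\<close>.
\<close>

definition hausdorff_gauge :: "real \<Rightarrow> 'a::metric_space set \<Rightarrow> ennreal" where
  "hausdorff_gauge s U =
     (if U = {} then 0 else if s = 0 then 1
      else ennreal (unit_ball_vol s * (diameter U / 2) powr s))"

text \<open>Boundedness is required explicitly: \<open>diameter\<close> is unspecified on unbounded sets.\<close>

definition hausdorff_content :: "real \<Rightarrow> real \<Rightarrow> 'a::metric_space set \<Rightarrow> ennreal" where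
  "hausdorff_content s \<delta> A =
     Inf {\<Sum>n. hausdorff_gauge s (U n) | U :: nat \<Rightarrow> 'a set.
            A \<subseteq> (\<Union>n. U n) \<and> (\<forall>n. bounded (U n) \<and> diameter (U n) \<le> \<delta>)}"

text \<open>The Hausdorff (outer) measure, defined for arbitrary sets.\<close>

definition hausdorff_measure :: "real \<Rightarrow> 'a::metric_space set \<Rightarrow> ennreal" where
  "hausdorff_measure s A = (SUP \<delta>\<in>{0<..}. hausdorff_content s \<delta> A)"

definition hausdorff_dim :: "'a::metric_space set \<Rightarrow> ereal" where
  "hausdorff_dim A = Inf {ereal s | s. 0 \<le> s \<and> hausdorff_measure s A = 0}"

end

theory Submission
  imports Defs
begin

text \<open>
Let \<open>n\<close> be the dimension of space-time, \<open>V\<close> the entropy field and \<open>p = r / (r - 1)\<close>, so that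
\<open>s = n - p\<close>.  If \<open>\<phi> \<ge> 0\<close> is a test function with \<open>\<phi> \<ge> 1\<close> on a set \<open>A\<close>, then
\<open>D A \<le> \<integral>\<phi> dD = \<integral>V \<bullet> \<nabla>\<phi> \<le> \<integral>|V| |\<nabla>\<phi>|\<close> (\<open>measure_le_flux\<close>).  Hence \<open>D\<close> is controlled by a
\<open>p\<close>-capacity, and sets of finite \<open>H\<^sup>s\<close> measure are too small for the capacity to charge them.

The point that needs care is the test function.  For a finite family of balls of radii \<open>\<rho> i\<close>
with no bound on their overlap, \<open>\<phi>\<close> is taken to be at least \<open>1\<close> on the balls, to vanish off the
doubled balls, and to satisfy \<open>|\<nabla>\<phi>|\<^sup>p \<le> C (\<Sum>i. \<rho> i\<^sup>-\<^sup>p 1_i)\<close>, where \<open>1_i\<close> is the indicator function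
of the \<open>i\<close>-th doubled ball (\<open>ball_family_cutoff\<close>).  The maximum of individual bumps would have this
property but is not smooth.  A smooth substitute comes from \<open>f t = exp (- 1 / t)\<close>, extended by \<open>0\<close>
to \<open>t \<le> 0\<close>: put \<open>\<psi> i z = f (4 - |z - c i|\<^sup>2 / (\<rho> i)\<^sup>2)\<close> and let \<open>\<phi>\<close> be a multiple of \<open>f (\<Sum>i. \<psi> i)\<close>.
Two growth estimates make this work: \<open>f' \<le> 2 p\<^sup>2 f powr (1 - 1/p)\<close>, used for the derivatives of
the \<open>\<psi> i\<close>, and \<open>f' t * (t + 1) \<le> 2\<close>, used for the outer \<open>f\<close>.

Integrating the gradient bound gives \<open>\<integral>|\<nabla>\<phi>|\<^sup>p \<le> C' (\<Sum>i. \<rho> i powr s)\<close>, which is of the order of \<open>H\<^sup>s B\<close>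
when the balls come from a nearly optimal covering of \<open>B\<close>.  For \<open>r < \<infinity>\<close>, Young's inequality with a
weight \<open>\<tau>\<close> yields
\<open>D B \<le> C' \<tau>\<^sup>p (\<Sum>i. \<rho> i powr s) + \<tau>\<^sup>-\<^sup>r (\<integral>\<^bsub>W\<^esub> |V|\<^sup>r)\<close> for every open \<open>W\<close> that contains the doubled balls
(\<open>finite_balls_le_power\<close>).  Since \<open>p > 1\<close>, a set of finite \<open>H\<^sup>s\<close> measure is Lebesgue null, so \<open>W\<close> can
be chosen with arbitrarily small energy: first \<open>\<tau>\<close> is made small, then \<open>W\<close>.  For \<open>r = \<infinity>\<close> one has
\<open>p = 1\<close>, \<open>V\<close> is locally bounded, and \<open>D B\<close> is at most a constant times \<open>\<Sum>i. \<rho> i powr (n - 1)\<close>, which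
is as small as desired if \<open>H\<^sup>n\<^sup>-\<^sup>1 B = 0\<close>.

The bound on the dimension follows, because \<open>H\<^sup>t S = 0\<close> for some \<open>t < s\<close> forces \<open>H\<^sup>s S = 0\<close>, and
therefore \<open>D S = 0\<close> by exhaustion with compact sets.
\<close>

section \<open>Calculus of smooth functions\<close>

text \<open>
Induction on the order of differentiability only ever needs some family of derivatives \<open>D\<close>; this
rule and the matching elimination rule hide the choice made by \<open>frechet_derivative\<close>.
\<close>

lemma Ck_on_UNIV_SucI:
  fixes f :: "'a::euclidean_space \<Rightarrow> 'b::real_normed_vector"
  assumes "\<And>z. (f has_derivative D z) (at z)"
    and "\<And>b. b \<in> Basis \<Longrightarrow> Ck_on k UNIV (\<lambda>z. D z b)"
  shows "Ck_on (Suc k) UNIV f"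
proof -
  have "frechet_derivative f (at z) = D z" for z
    using frechet_derivative_at[OF assms(1)] by simp
  then show ?thesis
    using assms by (auto simp: differentiable_def)
qed

lemma Ck_on_UNIV_SucD:
  assumes "Ck_on (Suc k) UNIV f"
  shows "Ck_on k UNIV f"
  using assms
proof (induction k arbitrary: f)
  case 0
  then show ?case
    by (auto intro!: differentiable_imp_continuous_on simp: differentiable_on_def)
next
  case (Suc k)
  then show ?case
    by (metis Ck_on.simps(2))
qed

lemma Ck_on_UNIV_SucE:
  fixes f :: "'a::euclidean_space \<Rightarrow> 'b::real_normed_vector"
  assumes "Ck_on (Suc k) UNIV f"
  obtains D where "\<And>z. (f has_derivative D z) (at z)"
    and "\<And>b. b \<in> Basis \<Longrightarrow> Ck_on k UNIV (\<lambda>z. D z b)"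
proof
  show "(f has_derivative frechet_derivative f (at z)) (at z)" for z
    using assms by (simp add: frechet_derivative_works)
  show "Ck_on k UNIV (\<lambda>z. frechet_derivative f (at z) b)" if "b \<in> Basis" for b
    using assms that by simp
qed

lemma Ck_on_UNIV_const: "Ck_on k UNIV (\<lambda>z::'a::euclidean_space. c)"
proof (induction k arbitrary: c)
  case (Suc k)
  show ?case
    by (rule Ck_on_UNIV_SucI[where D = "\<lambda>_ _. 0"]) (auto intro: Suc)
qed simp

lemma Ck_on_UNIV_add:
  assumes "Ck_on k UNIV f" "Ck_on k UNIV g"
  shows "Ck_on k UNIV (\<lambda>z. f z + g z)"
  using assms
proof (induction k arbitrary: f g)
  case 0
  then show ?case by (simp add: continuous_on_add)
next
  case (Suc k)
  obtain Df where Df: "\<And>z. (f has_derivative Df z) (at z)" "\<And>b. b \<in> Basis \<Longrightarrow> Ck_on k UNIV (\<lambda>z. Df z b)"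
    using Ck_on_UNIV_SucE[OF Suc.prems(1)] by metis
  obtain Dg where Dg: "\<And>z. (g has_derivative Dg z) (at z)" "\<And>b. b \<in> Basis \<Longrightarrow> Ck_on k UNIV (\<lambda>z. Dg z b)"
    using Ck_on_UNIV_SucE[OF Suc.prems(2)] by metis
  show ?case
    by (rule Ck_on_UNIV_SucI[where D = "\<lambda>z b. Df z b + Dg z b"])
       (use Df Dg in \<open>auto intro: has_derivative_add Suc.IH\<close>)
qed

lemma Ck_on_UNIV_mult:
  fixes f g :: "'a::euclidean_space \<Rightarrow> real"
  assumes "Ck_on k UNIV f" "Ck_on k UNIV g"
  shows "Ck_on k UNIV (\<lambda>z. f z * g z)"
  using assms
proof (induction k arbitrary: f g)
  case 0
  then show ?case by (simp add: continuous_on_mult)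
next
  case (Suc k)
  obtain Df where Df: "\<And>z. (f has_derivative Df z) (at z)" "\<And>b. b \<in> Basis \<Longrightarrow> Ck_on k UNIV (\<lambda>z. Df z b)"
    using Ck_on_UNIV_SucE[OF Suc.prems(1)] by metis
  obtain Dg where Dg: "\<And>z. (g has_derivative Dg z) (at z)" "\<And>b. b \<in> Basis \<Longrightarrow> Ck_on k UNIV (\<lambda>z. Dg z b)"
    using Ck_on_UNIV_SucE[OF Suc.prems(2)] by metis
  show ?case
  proof (rule Ck_on_UNIV_SucI)
    show "((\<lambda>z. f z * g z) has_derivative (\<lambda>v. f z * Dg z v + Df z v * g z)) (at z)" for z
      by (rule has_derivative_mult[OF Df(1) Dg(1)])
    show "Ck_on k UNIV (\<lambda>z. f z * Dg z b + Df z b * g z)" if "b \<in> Basis" for b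
      by (rule Ck_on_UNIV_add; rule Suc.IH)
         (rule Df(2)[OF that] Dg(2)[OF that] Ck_on_UNIV_SucD[OF Suc.prems(1)] Ck_on_UNIV_SucD[OF Suc.prems(2)])+
  qed
qed

lemma Ck_on_UNIV_compose:
  fixes f :: "'a::euclidean_space \<Rightarrow> real" and h :: "real \<Rightarrow> real"
  assumes "Ck_on k UNIV h" "Ck_on k UNIV f"
  shows "Ck_on k UNIV (\<lambda>z. h (f z))"
  using assms
proof (induction k arbitrary: f h)
  case 0
  then show ?case by (auto intro: continuous_on_compose2)
next
  case (Suc k)
  obtain Df where Df: "\<And>z. (f has_derivative Df z) (at z)" "\<And>b. b \<in> Basis \<Longrightarrow> Ck_on k UNIV (\<lambda>z. Df z b)"
    using Ck_on_UNIV_SucE[OF Suc.prems(2)] by metis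
  obtain Dh where Dh: "\<And>z. (h has_derivative Dh z) (at z)" "\<And>b. b \<in> Basis \<Longrightarrow> Ck_on k UNIV (\<lambda>z. Dh z b)"
    using Ck_on_UNIV_SucE[OF Suc.prems(1)] by metis
  \<comment> \<open>The chain rule needs only the partial derivative of the outer function in the direction \<open>1\<close>.\<close>
  have lin: "Dh t x = x * Dh t 1" for t x
    using linear_scale[OF has_derivative_linear[OF Dh(1)], of t x 1] by simp
  show ?case
  proof (rule Ck_on_UNIV_SucI)
    show "((\<lambda>z. h (f z)) has_derivative (\<lambda>v. Dh (f z) (Df z v))) (at z)" for z
      using diff_chain_at[OF Df(1) Dh(1)] by (simp add: o_def)
    fix b :: 'a assume b: "b \<in> Basis"
    have "(\<lambda>z. Dh (f z) (Df z b)) = (\<lambda>z. Df z b * Dh (f z) 1)"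
      by (rule ext) (rule lin)
    moreover have "Ck_on k UNIV (\<lambda>z. Df z b * Dh (f z) 1)"
      by (rule Ck_on_UNIV_mult[OF Df(2)[OF b] Suc.IH[OF Dh(2) Ck_on_UNIV_SucD[OF Suc.prems(2)]]]) simp
    ultimately show "Ck_on k UNIV (\<lambda>z. Dh (f z) (Df z b))"
      by simp
  qed
qed

lemma Ck_on_UNIV_inner: "Ck_on k UNIV (\<lambda>z::'a::euclidean_space. (z - c) \<bullet> b)"
proof (cases k)
  case 0
  then show ?thesis by (auto intro!: continuous_intros)
next
  case (Suc j)
  show ?thesis unfolding Suc
  proof (rule Ck_on_UNIV_SucI)
    show "((\<lambda>z. (z - c) \<bullet> b) has_derivative (\<lambda>v. v \<bullet> b)) (at z)" for z :: 'a
      by (rule has_derivative_eq_rhs, (rule derivative_intros)+) simp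
  qed (rule Ck_on_UNIV_const)
qed

lemma smooth_on_UNIV_const: "smooth_on UNIV (\<lambda>z::'a::euclidean_space. c)"
  unfolding smooth_on_def using Ck_on_UNIV_const by blast

lemma smooth_on_UNIV_add:
  "smooth_on UNIV f \<Longrightarrow> smooth_on UNIV g \<Longrightarrow> smooth_on UNIV (\<lambda>z. f z + g z)"
  unfolding smooth_on_def using Ck_on_UNIV_add by blast

lemma smooth_on_UNIV_mult:
  fixes f g :: "'a::euclidean_space \<Rightarrow> real"
  shows "smooth_on UNIV f \<Longrightarrow> smooth_on UNIV g \<Longrightarrow> smooth_on UNIV (\<lambda>z. f z * g z)"
  unfolding smooth_on_def using Ck_on_UNIV_mult by blast

lemma smooth_on_UNIV_compose:
  fixes f :: "'a::euclidean_space \<Rightarrow> real" and h :: "real \<Rightarrow> real"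
  shows "smooth_on UNIV h \<Longrightarrow> smooth_on UNIV f \<Longrightarrow> smooth_on UNIV (\<lambda>z. h (f z))"
  unfolding smooth_on_def using Ck_on_UNIV_compose by blast

lemma smooth_on_UNIV_sum:
  assumes "\<And>i. i \<in> I \<Longrightarrow> smooth_on UNIV (f i)"
  shows "smooth_on UNIV (\<lambda>z::'a::euclidean_space. \<Sum>i\<in>I. f i z)"
  using assms
  by (induction I rule: infinite_finite_induct)
     (simp_all add: smooth_on_UNIV_const smooth_on_UNIV_add)

lemma smooth_on_UNIV_dist_square:
  "smooth_on UNIV (\<lambda>z::'a::euclidean_space. (norm (z - c))\<^sup>2)"
  unfolding smooth_on_def
proof
  fix k
  have "Ck_on (Suc k) UNIV (\<lambda>z::'a. (norm (z - c))\<^sup>2)"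
  proof (rule Ck_on_UNIV_SucI)
    show "((\<lambda>z. (norm (z - c))\<^sup>2) has_derivative (\<lambda>v. (z - c) \<bullet> v + (z - c) \<bullet> v)) (at z)" for z
      unfolding power2_norm_eq_inner
      by (auto intro!: derivative_eq_intros simp: inner_commute)
    show "Ck_on k UNIV (\<lambda>z. (z - c) \<bullet> b + (z - c) \<bullet> b)" for b
      by (intro Ck_on_UNIV_add Ck_on_UNIV_inner)
  qed
  then show "Ck_on k UNIV (\<lambda>z::'a. (norm (z - c))\<^sup>2)"
    by (rule Ck_on_UNIV_SucD)
qed

section \<open>A flat function and the cutoff of a family of balls\<close>

text \<open>
The factor \<open>poly P (1/t)\<close> makes the family closed under differentiation, so that the smoothness of
all its members, in particular of \<open>exp (- 1 / t)\<close>, follows by a single induction.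
\<close>

definition flat_exp_poly :: "real poly \<Rightarrow> real \<Rightarrow> real" where
  "flat_exp_poly P t = (if t \<le> 0 then 0 else poly P (1/t) * exp (- (1/t)))"

abbreviation flat_exp :: "real \<Rightarrow> real" where
  "flat_exp \<equiv> flat_exp_poly 1"

lemma poly_mult_exp_minus_tendsto_0: "((\<lambda>x::real. poly P x * exp (-x)) \<longlongrightarrow> 0) at_top"
proof -
  have "((\<lambda>x::real. \<Sum>i\<le>degree P. coeff P i * (x ^ i / exp x)) \<longlongrightarrow> (\<Sum>i\<le>degree P. coeff P i * 0)) at_top"
    by (intro tendsto_intros tendsto_power_div_exp_0)
  then show ?thesis
    by (simp add: poly_altdef sum_distrib_right sum_divide_distrib exp_minus field_simps)
qed

text \<open>
For \<open>t > 0\<close> the derivative of \<open>P(1/t) exp (- 1 / t)\<close> is \<open>t\<^sup>-\<^sup>2 (P - P')(1/t) exp (- 1 / t)\<close>.  At the origin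
the difference quotient is \<open>x P(x) exp (- x)\<close> with \<open>x = 1/t\<close>, which tends to \<open>0\<close>.
\<close>

lemma flat_exp_poly_has_real_derivative:
  "(flat_exp_poly P has_real_derivative flat_exp_poly ([:0, 0, 1:] * (P - pderiv P)) t) (at t)"
proof -
  consider "t < 0" | "t = 0" | "t > 0" by linarith
  then show ?thesis
  proof cases
    case 1
    have D: "((\<lambda>_. 0) has_real_derivative 0) (at t)" by simp
    have "eventually (\<lambda>x. x < 0) (nhds t)"
      using 1 by (intro eventually_nhds_in_open[of "{..<0}", simplified]) auto
    then have ev: "eventually (\<lambda>x. 0 = flat_exp_poly P x) (nhds t)"
      by eventually_elim (simp add: flat_exp_poly_def)
    have "(flat_exp_poly P has_real_derivative 0) (at t)"
      by (rule DERIV_cong_ev[THEN iffD1, OF refl ev refl D])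
    then show ?thesis
      using 1 by (simp add: flat_exp_poly_def)
  next
    case 2
    have "((\<lambda>h. flat_exp_poly P h / h) \<longlongrightarrow> 0) (at_right 0)"
    proof (rule Lim_transform_eventually)
      show "((\<lambda>h. poly (pCons 0 P) (inverse h) * exp (- inverse h)) \<longlongrightarrow> 0) (at_right 0)"
        by (rule filterlim_compose[OF poly_mult_exp_minus_tendsto_0 filterlim_inverse_at_top_right])
      show "eventually (\<lambda>h. poly (pCons 0 P) (inverse h) * exp (- inverse h) = flat_exp_poly P h / h) (at_right 0)"
        by (auto simp: eventually_at_filter flat_exp_poly_def field_simps)
    qed
    moreover have "((\<lambda>h. flat_exp_poly P h / h) \<longlongrightarrow> 0) (at_left 0)"
      by (rule Lim_transform_eventually[OF tendsto_const])
         (auto simp: eventually_at_filter flat_exp_poly_def)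
    ultimately have "((\<lambda>h. flat_exp_poly P h / h) \<longlongrightarrow> 0) (at 0)"
      by (rule filterlim_split_at[rotated])
    then show ?thesis
      using 2 by (simp add: DERIV_def flat_exp_poly_def)
  next
    case 3
    have D: "((\<lambda>x. poly P (1/x) * exp (- (1/x))) has_real_derivative
            poly P (1/t) * (exp (- (1/t)) * (1/t\<^sup>2)) + poly (pderiv P) (1/t) * (- (1/t\<^sup>2)) * exp (- (1/t))) (at t)"
      using 3
      by (auto intro!: derivative_eq_intros DERIV_chain2[OF poly_DERIV] simp: power2_eq_square field_simps)
    have "eventually (\<lambda>x. x > 0) (nhds t)"
      using 3 by (intro eventually_nhds_in_open[of "{0<..}", simplified]) auto
    then have ev: "eventually (\<lambda>x. poly P (1/x) * exp (- (1/x)) = flat_exp_poly P x) (nhds t)"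
      by eventually_elim (simp add: flat_exp_poly_def)
    have "(flat_exp_poly P has_real_derivative
            poly P (1/t) * (exp (- (1/t)) * (1/t\<^sup>2)) + poly (pderiv P) (1/t) * (- (1/t\<^sup>2)) * exp (- (1/t))) (at t)"
      by (rule DERIV_cong_ev[THEN iffD1, OF refl ev refl D])
    moreover have "poly P (1/t) * (exp (- (1/t)) * (1/t\<^sup>2)) + poly (pderiv P) (1/t) * (- (1/t\<^sup>2)) * exp (- (1/t))
        = flat_exp_poly ([:0, 0, 1:] * (P - pderiv P)) t"
      using 3 by (simp add: flat_exp_poly_def power2_eq_square algebra_simps)
    ultimately show ?thesis
      by simp
  qed
qed

lemma smooth_on_flat_exp_poly: "smooth_on UNIV (flat_exp_poly P)"
  unfolding smooth_on_def
proof
  fix k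
  show "Ck_on k UNIV (flat_exp_poly P)"
  proof (induction k arbitrary: P)
    case 0
    show ?case
      unfolding Ck_on.simps
      using DERIV_isCont[OF flat_exp_poly_has_real_derivative] continuous_at_imp_continuous_on by blast
  next
    case (Suc k)
    show ?case
      by (rule Ck_on_UNIV_SucI[where D = "\<lambda>t v. flat_exp_poly ([:0, 0, 1:] * (P - pderiv P)) t * v"])
         (use flat_exp_poly_has_real_derivative Suc.IH in \<open>auto simp: has_field_derivative_def\<close>)
  qed
qed

definition flat_exp_deriv :: "real \<Rightarrow> real" where
  "flat_exp_deriv t = (if t \<le> 0 then 0 else exp (- (1/t)) / t\<^sup>2)"

lemma flat_exp_eq: "flat_exp t = (if t \<le> 0 then 0 else exp (- (1/t)))"
  by (simp add: flat_exp_poly_def)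

lemma flat_exp_has_real_derivative: "(flat_exp has_real_derivative flat_exp_deriv t) (at t)"
proof -
  have "flat_exp_poly ([:0, 0, 1:] * (1 - pderiv 1)) t = flat_exp_deriv t"
    by (simp add: flat_exp_poly_def flat_exp_deriv_def power2_eq_square)
  then show ?thesis
    using flat_exp_poly_has_real_derivative[of 1 t] by simp
qed

lemma flat_exp_nonneg: "0 \<le> flat_exp t"
  by (simp add: flat_exp_eq)

lemma flat_exp_mono: "s \<le> t \<Longrightarrow> flat_exp s \<le> flat_exp t"
  by (auto simp: flat_exp_eq divide_simps)

lemma flat_exp_deriv_nonneg: "0 \<le> flat_exp_deriv t"
  by (simp add: flat_exp_deriv_def)

text \<open>
With \<open>x = 1/t\<close> the claim is \<open>x\<^sup>2 \<le> 2 p\<^sup>2 exp (x/p)\<close>, a consequence of \<open>y\<^sup>2 / 2 \<le> exp y\<close>.  A bump built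
from \<open>flat_exp\<close> thus has a gradient bounded by almost its own size, with an arbitrarily small loss
in the exponent.
\<close>

lemma flat_exp_deriv_le_powr:
  assumes "1 \<le> p"
  shows "flat_exp_deriv t \<le> 2 * p\<^sup>2 * flat_exp t powr (1 - 1/p)"
proof (cases "t \<le> 0")
  case False
  define x where "x = 1/t"
  have x: "x > 0" using False by (simp add: x_def)
  have "(x/p)\<^sup>2 / 2 \<le> exp (x/p)"
    using exp_lower_Taylor_quadratic[of "x/p"] x assms by (smt (verit) divide_nonneg_nonneg)
  then have "x\<^sup>2 \<le> 2 * p\<^sup>2 * exp (x/p)"
    using assms by (simp add: power_divide divide_simps mult.commute)
  then have "exp (-x) * x\<^sup>2 \<le> exp (-x) * (2 * p\<^sup>2 * exp (x/p))"
    by (intro mult_left_mono) auto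
  also have "\<dots> = 2 * p\<^sup>2 * (exp (-x) powr (1 - 1/p))"
    by (simp add: powr_def exp_add[symmetric] algebra_simps)
  finally show ?thesis
    using False by (simp add: flat_exp_deriv_def flat_exp_eq x_def power_divide)
qed (simp add: flat_exp_deriv_def)

text \<open>
The derivative decays like \<open>t\<^sup>-\<^sup>2\<close> at infinity.  This compensates the growth of a sum of bumps at the
points where many of them overlap.
\<close>

lemma flat_exp_deriv_mult_le: "flat_exp_deriv t * (t + 1) \<le> 2"
proof (cases "t \<le> 0")
  case False
  define x where "x = 1/t"
  have x: "x > 0" using False by (simp add: x_def)
  have "x + x\<^sup>2 \<le> 2 * exp x"
    using exp_lower_Taylor_quadratic[of x] x by simp
  then have "exp (-x) * (x + x\<^sup>2) \<le> exp (-x) * (2 * exp x)"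
    by (intro mult_left_mono) auto
  also have "\<dots> = 2" by (simp add: exp_minus)
  finally have "exp (-x) * (x + x\<^sup>2) \<le> 2" .
  moreover have "flat_exp_deriv t * (t + 1) = exp (-x) * (x + x\<^sup>2)"
    using False by (simp add: flat_exp_deriv_def x_def power2_eq_square field_simps)
  ultimately show ?thesis by simp
qed (simp add: flat_exp_deriv_def)

text \<open>
A form of Young's inequality with constants \<open>1\<close> that covers \<open>p = 1\<close>: one of \<open>b \<le> x powr (1/p)\<close> and
\<open>x \<le> b powr p\<close> holds, and the product is then at most \<open>x\<close> or \<open>b powr p\<close>, respectively.
\<close>

lemma powr_mult_le_add_powr:
  fixes x b p :: real
  assumes "1 \<le> p" "0 \<le> x" "0 \<le> b"
  shows "x powr (1 - 1/p) * b \<le> x + b powr p"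
proof (cases "b \<le> x powr (1/p)")
  case True
  then have "x powr (1 - 1/p) * b \<le> x powr (1 - 1/p) * x powr (1/p)"
    by (intro mult_left_mono) auto
  also have "\<dots> = x"
    using assms by (cases "x = 0") (auto simp: powr_add[symmetric])
  finally show ?thesis
    by (smt (verit) powr_ge_zero)
next
  case False
  then have b: "0 < b"
    by (smt (verit) powr_ge_zero)
  have "x = (x powr (1/p)) powr p"
    using assms by (simp add: powr_powr)
  also have "\<dots> \<le> b powr p"
    using False assms by (intro powr_mono2) auto
  finally have "x powr (1 - 1/p) * b \<le> (b powr p) powr (1 - 1/p) * b"
    using assms by (intro mult_right_mono powr_mono2) auto
  also have "(b powr p) powr (1 - 1/p) = b powr (p - 1)"
    using assms by (simp add: powr_powr right_diff_distrib)
  also have "b powr (p - 1) * b = b powr p"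
    using b by (simp add: powr_diff)
  finally show ?thesis
    using assms by linarith
qed

text \<open>
Young's inequality applied termwise after dividing by the \<open>p\<close>-norm \<open>N\<close> of \<open>a\<close>; the numbers
\<open>(a i / N) powr p\<close> add up to \<open>1\<close>.
\<close>

lemma sum_powr_mult_le:
  fixes x a :: "'i \<Rightarrow> real"
  assumes "finite I" "1 \<le> p" "\<And>i. i \<in> I \<Longrightarrow> 0 \<le> x i" "\<And>i. i \<in> I \<Longrightarrow> 0 \<le> a i"
  shows "(\<Sum>i\<in>I. x i powr (1 - 1/p) * a i) \<le> ((\<Sum>i\<in>I. x i) + 1) * (\<Sum>i\<in>I. a i powr p) powr (1/p)"
proof -
  define S where "S = (\<Sum>i\<in>I. a i powr p)"
  define N where "N = S powr (1/p)"
  have S0: "0 \<le> S" unfolding S_def by (simp add: sum_nonneg)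
  show ?thesis
  proof (cases "S = 0")
    case True
    then have "\<forall>i\<in>I. a i = 0"
      using assms(1,4) unfolding S_def by (subst (asm) sum_nonneg_eq_0_iff) auto
    then show ?thesis by (simp add: sum_nonneg assms)
  next
    case False
    then have N: "N > 0" using S0 by (simp add: N_def)
    have Np: "N powr p = S"
      using S0 assms(2) by (simp add: N_def powr_powr)
    have "(\<Sum>i\<in>I. x i powr (1 - 1/p) * (a i / N)) \<le> (\<Sum>i\<in>I. x i + (a i / N) powr p)"
      using N assms by (intro sum_mono powr_mult_le_add_powr) auto
    also have "\<dots> = (\<Sum>i\<in>I. x i) + (\<Sum>i\<in>I. a i powr p / S)"
      using N assms by (simp add: sum.distrib powr_divide Np)
    also have "(\<Sum>i\<in>I. a i powr p / S) = 1"
      using False by (simp add: sum_divide_distrib[symmetric] S_def)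
    finally have "(\<Sum>i\<in>I. x i powr (1 - 1/p) * a i) / N \<le> (\<Sum>i\<in>I. x i) + 1"
      by (simp add: sum_divide_distrib)
    then show ?thesis
      using N by (simp add: pos_divide_le_eq N_def S_def)
  qed
qed

definition ball_bump :: "'a::euclidean_space \<Rightarrow> real \<Rightarrow> 'a \<Rightarrow> real" where
  "ball_bump c \<rho> z = flat_exp (4 - (norm (z - c))\<^sup>2 / \<rho>\<^sup>2)"

lemma ball_bump_nonneg: "0 \<le> ball_bump c \<rho> z"
  by (simp add: ball_bump_def flat_exp_nonneg)

lemma smooth_on_ball_bump: "smooth_on UNIV (ball_bump c \<rho>)"
proof -
  have "smooth_on UNIV (\<lambda>z. 4 + (- 1 / \<rho>\<^sup>2) * (norm (z - c))\<^sup>2)"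
    by (rule smooth_on_UNIV_add[OF smooth_on_UNIV_const
          smooth_on_UNIV_mult[OF smooth_on_UNIV_const smooth_on_UNIV_dist_square]])
  then have "smooth_on UNIV (\<lambda>z. flat_exp (4 + (- 1 / \<rho>\<^sup>2) * (norm (z - c))\<^sup>2))"
    by (rule smooth_on_UNIV_compose[OF smooth_on_flat_exp_poly])
  then show ?thesis
    by (simp add: ball_bump_def[abs_def])
qed

text \<open>
On the ball the argument of \<open>flat_exp\<close> is at least \<open>4 - 1 = 3\<close>.
\<close>

lemma ball_bump_ge:
  assumes "z \<in> ball c \<rho>"
  shows "flat_exp 3 \<le> ball_bump c \<rho> z"
proof -
  have "norm (z - c) \<le> \<rho>" and \<rho>: "0 < \<rho>"
    using assms by (auto simp: dist_norm norm_minus_commute intro: le_less_trans[OF norm_ge_zero])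
  then have "(norm (z - c))\<^sup>2 \<le> \<rho>\<^sup>2"
    by (intro power_mono) auto
  then have "3 \<le> 4 - (norm (z - c))\<^sup>2 / \<rho>\<^sup>2"
    using \<rho> by (simp add: divide_simps)
  then show ?thesis
    unfolding ball_bump_def by (rule flat_exp_mono)
qed

lemma outside_cball_arg_nonpos:
  assumes "0 < \<rho>" "z \<notin> cball c (2 * \<rho>)"
  shows "4 - (norm (z - c))\<^sup>2 / \<rho>\<^sup>2 \<le> 0"
proof -
  have "(2 * \<rho>)\<^sup>2 \<le> (norm (z - c))\<^sup>2"
    using assms by (intro power_mono) (auto simp: dist_norm norm_minus_commute)
  then show ?thesis
    using assms by (simp add: divide_simps)
qed

lemma ball_bump_eq_0: "0 < \<rho> \<Longrightarrow> z \<notin> cball c (2 * \<rho>) \<Longrightarrow> ball_bump c \<rho> z = 0"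
  using outside_cball_arg_nonpos[of \<rho> z c] by (simp add: ball_bump_def flat_exp_eq)

text \<open>
The inner function has gradient of norm \<open>2 |z - c| / \<rho>\<^sup>2 \<le> 4 / \<rho>\<close> on the doubled ball; the outer
derivative is estimated by \<open>flat_exp_deriv_le_powr\<close>.
\<close>

lemma ball_bump_derivative:
  assumes "0 < \<rho>" "1 \<le> p"
  obtains D where "(ball_bump c \<rho> has_derivative D) (at z)"
    and "\<And>v. \<bar>D v\<bar> \<le> 8 * p\<^sup>2 * norm v * (ball_bump c \<rho> z powr (1 - 1/p) * (indicator (cball c (2 * \<rho>)) z / \<rho>))"
proof
  define t where "t = 4 - (norm (z - c))\<^sup>2 / \<rho>\<^sup>2"
  define D where "D = (\<lambda>v. flat_exp_deriv t * (- (2 * ((z - c) \<bullet> v) / \<rho>\<^sup>2)))"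
  have "((\<lambda>z. 4 - (norm (z - c))\<^sup>2 / \<rho>\<^sup>2) has_derivative (\<lambda>v. - (2 * ((z - c) \<bullet> v) / \<rho>\<^sup>2))) (at z)"
    unfolding power2_norm_eq_inner
    by (rule has_derivative_eq_rhs, (rule derivative_intros)+) (use assms in \<open>simp_all add: inner_commute algebra_simps\<close>)
  moreover have "(flat_exp has_derivative (*) (flat_exp_deriv t)) (at t)"
    using flat_exp_has_real_derivative by (simp add: has_field_derivative_def)
  ultimately have "(flat_exp \<circ> (\<lambda>z. 4 - (norm (z - c))\<^sup>2 / \<rho>\<^sup>2) has_derivative
      (*) (flat_exp_deriv t) \<circ> (\<lambda>v. - (2 * ((z - c) \<bullet> v) / \<rho>\<^sup>2))) (at z)"
    unfolding t_def by (rule diff_chain_at)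
  then show "(ball_bump c \<rho> has_derivative D) (at z)"
    by (simp add: o_def ball_bump_def[abs_def] D_def)
  fix v
  show "\<bar>D v\<bar> \<le> 8 * p\<^sup>2 * norm v * (ball_bump c \<rho> z powr (1 - 1/p) * (indicator (cball c (2 * \<rho>)) z / \<rho>))"
  proof (cases "z \<in> cball c (2 * \<rho>)")
    case False
    then show ?thesis
      using outside_cball_arg_nonpos[OF assms(1) False] by (simp add: D_def t_def flat_exp_deriv_def)
  next
    case True
    have "\<bar>(z - c) \<bullet> v\<bar> \<le> norm (z - c) * norm v"
      by (rule Cauchy_Schwarz_ineq2)
    also have "\<dots> \<le> 2 * \<rho> * norm v"
      using True by (intro mult_right_mono) (auto simp: dist_norm norm_minus_commute)
    finally have "\<bar>D v\<bar> \<le> flat_exp_deriv t * (4 * norm v / \<rho>)"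
      unfolding D_def abs_mult using assms flat_exp_deriv_nonneg[of t]
      by (intro mult_mono) (auto simp: power2_eq_square divide_simps abs_mult)
    also have "\<dots> \<le> (2 * p\<^sup>2 * flat_exp t powr (1 - 1/p)) * (4 * norm v / \<rho>)"
      using assms by (intro mult_right_mono flat_exp_deriv_le_powr) auto
    finally show ?thesis
      using True by (simp add: ball_bump_def t_def mult_ac)
  qed
qed

lemma smooth_on_has_derivative:
  "smooth_on UNIV f \<Longrightarrow> (f has_derivative frechet_derivative f (at z)) (at z)"
  unfolding smooth_on_def using Ck_on.simps(2)[of 0 UNIV f] frechet_derivative_works by blast

text \<open>
A test function that witnesses an upper bound for the \<open>p\<close>-capacity of a union of balls: the
integral of the last estimate is of the order \<open>\<Sum>i\<in>I. \<rho> i powr (n - p)\<close> in dimension \<open>n\<close>, however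
much the balls overlap.
\<close>

definition ball_cutoff ::
  "real \<Rightarrow> real \<Rightarrow> nat set \<Rightarrow> (nat \<Rightarrow> 'a::euclidean_space) \<Rightarrow> (nat \<Rightarrow> real) \<Rightarrow> ('a \<Rightarrow> real) \<Rightarrow> bool" where
  "ball_cutoff p C I c \<rho> \<phi> \<longleftrightarrow>
     smooth_on UNIV \<phi> \<and> (\<forall>z. 0 \<le> \<phi> z) \<and>
     (\<forall>z \<in> (\<Union>i\<in>I. ball (c i) (\<rho> i)). 1 \<le> \<phi> z) \<and>
     {z. \<phi> z \<noteq> 0} \<subseteq> (\<Union>i\<in>I. cball (c i) (2 * \<rho> i)) \<and>
     (\<forall>z. onorm (frechet_derivative \<phi> (at z)) powr p
         \<le> C * (\<Sum>i\<in>I. indicator (cball (c i) (2 * \<rho> i)) z / \<rho> i powr p))"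

text \<open>
The cutoff is \<open>flat_exp Y / \<kappa>\<close>, where \<open>Y\<close> is the sum of the bumps.  By \<open>ball_bump_derivative\<close> and
\<open>sum_powr_mult_le\<close> the gradient of \<open>Y\<close> is at most a constant times \<open>(Y + 1) N\<close>, where \<open>N\<close> is the
\<open>p\<close>-norm of the numbers \<open>1 / \<rho> i\<close> over the doubled balls containing the point; the factor
\<open>Y + 1\<close> is absorbed by \<open>flat_exp_deriv_mult_le\<close>.  The constant depends on \<open>p\<close> only.
\<close>

lemma ball_family_cutoff:
  fixes p :: real
  assumes p: "1 \<le> p"
  obtains C where "0 \<le> C"
    and "\<And>(I::nat set) (c::nat \<Rightarrow> 'a::euclidean_space) (\<rho>::nat \<Rightarrow> real). finite I \<Longrightarrow> (\<And>i. i \<in> I \<Longrightarrow> 0 < \<rho> i) \<Longrightarrow>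
      \<exists>\<phi>. ball_cutoff p C I c \<rho> \<phi>"
proof
  \<comment> \<open>On each ball the corresponding bump, hence \<open>Y\<close>, is at least \<open>flat_exp 3\<close>.\<close>
  define \<kappa> where "\<kappa> = flat_exp (flat_exp 3)"
  define C where "C = (16 * p\<^sup>2 / \<kappa>) powr p"
  have \<kappa>: "0 < \<kappa>" by (simp add: \<kappa>_def flat_exp_eq)
  show "0 \<le> C" by (simp add: C_def)
  fix I :: "nat set" and c :: "nat \<Rightarrow> 'a" and \<rho> :: "nat \<Rightarrow> real"
  assume I: "finite I" and \<rho>: "\<And>i. i \<in> I \<Longrightarrow> 0 < \<rho> i"
  define Y where "Y = (\<lambda>z. \<Sum>i\<in>I. ball_bump (c i) (\<rho> i) z)"
  define \<phi> where "\<phi> = (\<lambda>z. (1/\<kappa>) * flat_exp (Y z))"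
  have smY: "smooth_on UNIV Y"
    unfolding Y_def by (intro smooth_on_UNIV_sum smooth_on_ball_bump)
  have sm: "smooth_on UNIV \<phi>"
    unfolding \<phi>_def
    by (rule smooth_on_UNIV_mult[OF smooth_on_UNIV_const smooth_on_UNIV_compose[OF smooth_on_flat_exp_poly smY]])
  have nonneg: "0 \<le> \<phi> z" for z
    using \<kappa> by (simp add: \<phi>_def flat_exp_nonneg)
  have ge1: "1 \<le> \<phi> z" if i: "i \<in> I" and z: "z \<in> ball (c i) (\<rho> i)" for i z
  proof -
    have "flat_exp 3 \<le> ball_bump (c i) (\<rho> i) z"
      using z by (rule ball_bump_ge)
    also have "\<dots> \<le> Y z"
      unfolding Y_def using I i by (intro member_le_sum) (auto simp: ball_bump_nonneg)
    finally have "\<kappa> \<le> flat_exp (Y z)"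
      unfolding \<kappa>_def by (rule flat_exp_mono)
    then show ?thesis
      using \<kappa> by (simp add: \<phi>_def)
  qed
  have supp: "\<phi> z = 0" if "z \<notin> (\<Union>i\<in>I. cball (c i) (2 * \<rho> i))" for z
  proof -
    have "Y z = 0"
      unfolding Y_def using that \<rho> by (intro sum.neutral ballI ball_bump_eq_0) auto
    then show ?thesis by (simp add: \<phi>_def flat_exp_eq)
  qed
  have grad: "onorm (frechet_derivative \<phi> (at z)) powr p
      \<le> C * (\<Sum>i\<in>I. indicator (cball (c i) (2 * \<rho> i)) z / \<rho> i powr p)" for z
  proof -
    define a where "a = (\<lambda>i. indicator (cball (c i) (2 * \<rho> i)) z / \<rho> i)"
    define N where "N = (\<Sum>i\<in>I. a i powr p) powr (1/p)"
    have "\<forall>i\<in>I. \<exists>D. (ball_bump (c i) (\<rho> i) has_derivative D) (at z) \<and>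
        (\<forall>v. \<bar>D v\<bar> \<le> 8 * p\<^sup>2 * norm v * (ball_bump (c i) (\<rho> i) z powr (1 - 1/p) * a i))"
      using ball_bump_derivative[OF \<rho> p] unfolding a_def by metis
    then obtain D where D: "\<And>i. i \<in> I \<Longrightarrow> (ball_bump (c i) (\<rho> i) has_derivative D i) (at z)"
      and D_le: "\<And>i v. i \<in> I \<Longrightarrow> \<bar>D i v\<bar> \<le> 8 * p\<^sup>2 * norm v * (ball_bump (c i) (\<rho> i) z powr (1 - 1/p) * a i)"
      by metis
    have DY: "(Y has_derivative (\<lambda>v. \<Sum>i\<in>I. D i v)) (at z)"
      unfolding Y_def by (intro has_derivative_sum D)
    have "(flat_exp has_derivative (*) (flat_exp_deriv (Y z))) (at (Y z))"
      using flat_exp_has_real_derivative by (simp add: has_field_derivative_def)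
    from has_derivative_mult_right[OF diff_chain_at[OF DY this], of "1/\<kappa>"]
    have "(\<phi> has_derivative (\<lambda>v. (1/\<kappa>) * (flat_exp_deriv (Y z) * (\<Sum>i\<in>I. D i v)))) (at z)"
      by (simp add: \<phi>_def o_def)
    then have fd: "frechet_derivative \<phi> (at z) = (\<lambda>v. (1/\<kappa>) * (flat_exp_deriv (Y z) * (\<Sum>i\<in>I. D i v)))"
      by (rule frechet_derivative_at[symmetric])
    have N0: "0 \<le> N" by (simp add: N_def)
    have a0: "0 \<le> a i" if "i \<in> I" for i
      using \<rho>[OF that] by (simp add: a_def)
    have bound: "\<bar>frechet_derivative \<phi> (at z) v\<bar> \<le> (16 * p\<^sup>2 / \<kappa> * N) * norm v" for v
    proof -
      have "\<bar>\<Sum>i\<in>I. D i v\<bar> \<le> (\<Sum>i\<in>I. 8 * p\<^sup>2 * norm v * (ball_bump (c i) (\<rho> i) z powr (1 - 1/p) * a i))"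
        using D_le by (intro order_trans[OF sum_abs] sum_mono) auto
      also have "\<dots> = 8 * p\<^sup>2 * norm v * (\<Sum>i\<in>I. ball_bump (c i) (\<rho> i) z powr (1 - 1/p) * a i)"
        by (simp add: sum_distrib_left)
      also have "\<dots> \<le> 8 * p\<^sup>2 * norm v * ((Y z + 1) * N)"
        unfolding Y_def N_def using I p a0
        by (intro mult_left_mono sum_powr_mult_le) (auto simp: ball_bump_nonneg)
      finally have "flat_exp_deriv (Y z) * \<bar>\<Sum>i\<in>I. D i v\<bar> \<le> flat_exp_deriv (Y z) * (8 * p\<^sup>2 * norm v * ((Y z + 1) * N))"
        by (intro mult_left_mono flat_exp_deriv_nonneg)
      also have "\<dots> = (flat_exp_deriv (Y z) * (Y z + 1)) * (8 * p\<^sup>2 * norm v * N)"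
        by simp
      also have "\<dots> \<le> 2 * (8 * p\<^sup>2 * norm v * N)"
        using N0 by (intro mult_right_mono flat_exp_deriv_mult_le) auto
      finally show ?thesis
        unfolding fd using \<kappa> flat_exp_deriv_nonneg[of "Y z"]
        by (simp add: abs_mult divide_simps mult_ac)
    qed
    have lin: "bounded_linear (frechet_derivative \<phi> (at z))"
      using smooth_on_has_derivative[OF sm] by (rule has_derivative_bounded_linear)
    have "onorm (frechet_derivative \<phi> (at z)) \<le> 16 * p\<^sup>2 / \<kappa> * N"
      using bound \<kappa> N0 by (intro onorm_bound) auto
    then have "onorm (frechet_derivative \<phi> (at z)) powr p \<le> (16 * p\<^sup>2 / \<kappa> * N) powr p"
      using p onorm_pos_le[OF lin] by (intro powr_mono2) auto
    also have "\<dots> = C * N powr p"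
      unfolding C_def by (rule powr_mult)
    also have "N powr p = (\<Sum>i\<in>I. a i powr p)"
      using p by (simp add: N_def powr_powr sum_nonneg)
    also have "\<dots> = (\<Sum>i\<in>I. indicator (cball (c i) (2 * \<rho> i)) z / \<rho> i powr p)"
      using \<rho> p by (intro sum.cong) (auto simp: a_def powr_divide indicator_def)
    finally show ?thesis .
  qed
  show "\<exists>\<phi>. ball_cutoff p C I c \<rho> \<phi>"
    unfolding ball_cutoff_def
  proof (intro exI[of _ \<phi>] conjI)
    show "{z. \<phi> z \<noteq> 0} \<subseteq> (\<Union>i\<in>I. cball (c i) (2 * \<rho> i))"
      using supp by blast
  qed (use sm nonneg ge1 grad in auto)
qed

section \<open>Hausdorff measure and coverings by balls\<close>

lemma hausdorff_measure_mono: "A \<subseteq> B \<Longrightarrow> hausdorff_measure s A \<le> hausdorff_measure s B"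
  unfolding hausdorff_measure_def hausdorff_content_def
  by (intro SUP_mono' Inf_superset_mono) blast

lemma hausdorff_cover:
  assumes "hausdorff_measure s B < H" "0 < \<delta>"
  obtains U :: "nat \<Rightarrow> 'a::metric_space set"
  where "B \<subseteq> (\<Union>n. U n)" "\<And>n. bounded (U n)" "\<And>n. diameter (U n) \<le> \<delta>"
    "(\<Sum>n. hausdorff_gauge s (U n)) < H"
proof -
  have "hausdorff_content s \<delta> B \<le> hausdorff_measure s B"
    unfolding hausdorff_measure_def using assms(2) by (intro SUP_upper) auto
  then have "hausdorff_content s \<delta> B < H"
    using assms(1) by (rule le_less_trans)
  then show ?thesis
    unfolding hausdorff_content_def Inf_less_iff using that by blast
qed

text \<open>
For sets of diameter at most \<open>2\<close> the half diameter is at most \<open>1\<close>, and the \<open>s\<close>-gauge is bounded by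
a multiple of the \<open>t\<close>-gauge.
\<close>

lemma hausdorff_measure_eq_0_mono:
  assumes "0 \<le> t" "t < s" "hausdorff_measure t (A::'a::metric_space set) = 0"
  shows "hausdorff_measure s A = 0"
proof -
  define K where "K = unit_ball_vol s / unit_ball_vol t"
  have K: "0 < K" using assms by (simp add: K_def)
  have gauge: "hausdorff_gauge s U \<le> ennreal K * hausdorff_gauge t U"
    if "bounded U" "diameter U \<le> 2" for U :: "'a set"
  proof -
    have d: "0 \<le> diameter U / 2" "diameter U / 2 \<le> 1"
      using that diameter_ge_0 by auto
    have "(diameter U / 2) powr s \<le> (if t = 0 then 1 else (diameter U / 2) powr t)"
      using d assms powr_mono'[of t s "diameter U / 2"] by (auto intro: powr_le1)
    then have "unit_ball_vol s * (diameter U / 2) powr s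
        \<le> K * (unit_ball_vol t * (if t = 0 then 1 else (diameter U / 2) powr t))"
      using assms unit_ball_vol_pos[of t] unit_ball_vol_pos[of s]
      by (simp add: K_def less_imp_neq[symmetric])
    then show ?thesis
      using assms K by (auto simp: hausdorff_gauge_def ennreal_mult[symmetric] intro!: ennreal_leI)
  qed
  have "hausdorff_content s \<delta> A \<le> 0" if "0 < \<delta>" for \<delta>
  proof (rule ennreal_le_epsilon)
    fix e :: real assume e: "0 < e"
    have "hausdorff_measure t A < ennreal (e / K)"
      using assms e K by simp
    moreover have "0 < min \<delta> 2" using that by simp
    ultimately obtain U :: "nat \<Rightarrow> 'a set" where U: "A \<subseteq> (\<Union>n. U n)" "\<And>n. bounded (U n)"
      "\<And>n. diameter (U n) \<le> min \<delta> 2" "(\<Sum>n. hausdorff_gauge t (U n)) < ennreal (e / K)"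
      by (rule hausdorff_cover) blast
    have "hausdorff_content s \<delta> A \<le> (\<Sum>n. hausdorff_gauge s (U n))"
      unfolding hausdorff_content_def using U by (intro Inf_lower) auto
    also have "\<dots> \<le> (\<Sum>n. ennreal K * hausdorff_gauge t (U n))"
      using U by (intro suminf_le gauge) auto
    also have "\<dots> = ennreal K * (\<Sum>n. hausdorff_gauge t (U n))"
      by (rule ennreal_suminf_cmult)
    also have "\<dots> \<le> ennreal K * ennreal (e / K)"
      using U(4) by (intro mult_left_mono) auto
    also have "\<dots> = ennreal e"
      using K e by (simp add: ennreal_mult[symmetric])
    finally show "hausdorff_content s \<delta> A \<le> 0 + ennreal e" by simp
  qed
  then show ?thesis
    by (auto simp: hausdorff_measure_def intro!: SUP_eq_const)
qed

text \<open>
The quotient turns the gauge of a set into the \<open>s\<close>-th power of its diameter; the additional \<open>1\<close>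
pays for enlarging the diameters to positive radii.
\<close>

definition cover_const :: "real \<Rightarrow> real" where
  "cover_const s = 2 powr s / unit_ball_vol s + 1"

text \<open>
A covering set may have diameter \<open>0\<close>, so the radius of a ball that replaces it has to be strictly
larger than the diameter.  Continuity of \<open>x powr s\<close> keeps the loss below \<open>\<epsilon>\<close>; for \<open>s = 0\<close> both the
power and the gauge are \<open>1\<close>.
\<close>

lemma ball_radius_from_gauge:
  fixes U :: "'a::metric_space set"
  assumes "0 \<le> s" "bounded U" "U \<noteq> {}" "0 < \<epsilon>" "0 < \<delta>"
  obtains \<rho> where "diameter U < \<rho>" "\<rho> \<le> diameter U + \<delta>"
    "ennreal (\<rho> powr s) \<le> ennreal (2 powr s / unit_ball_vol s) * hausdorff_gauge s U + ennreal \<epsilon>"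
proof -
  have d: "0 \<le> diameter U" using assms by (simp add: diameter_ge_0)
  show ?thesis
  proof (cases "s = 0")
    case True
    then show ?thesis
      using assms d by (intro that[of "diameter U + \<delta>"]) (auto simp: hausdorff_gauge_def)
  next
    case False
    have "continuous_on {0..} (\<lambda>x::real. x powr s)"
      using False assms by (intro continuous_on_powr') (auto intro!: continuous_intros)
    then obtain \<eta> where \<eta>: "0 < \<eta>"
      "\<And>x. 0 \<le> x \<Longrightarrow> dist x (diameter U) < \<eta> \<Longrightarrow> dist (x powr s) (diameter U powr s) < \<epsilon>"
      using d assms unfolding continuous_on_iff by (metis atLeast_iff)
    define \<rho> where "\<rho> = diameter U + min \<delta> (\<eta>/2)"
    have "dist (\<rho> powr s) (diameter U powr s) < \<epsilon>"
      using \<eta>(1) d assms by (intro \<eta>(2)) (auto simp: \<rho>_def dist_real_def)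
    then have "\<rho> powr s \<le> diameter U powr s + \<epsilon>"
      by (simp add: dist_real_def)
    also have "diameter U powr s = 2 powr s / unit_ball_vol s * (unit_ball_vol s * (diameter U / 2) powr s)"
      using d assms unit_ball_vol_pos[of s] by (simp add: powr_divide less_imp_neq[symmetric])
    finally have "ennreal (\<rho> powr s) \<le> ennreal (2 powr s / unit_ball_vol s * (unit_ball_vol s * (diameter U / 2) powr s) + \<epsilon>)"
      by (rule ennreal_leI)
    also have "\<dots> = ennreal (2 powr s / unit_ball_vol s) * hausdorff_gauge s U + ennreal \<epsilon>"
    proof -
      have gauge_eq: "hausdorff_gauge s U = ennreal (unit_ball_vol s * (diameter U / 2) powr s)"
        using False assms by (simp add: hausdorff_gauge_def)
      have s_pos: "0 \<le> s" by fact
      have gen: "ennreal (a * b + \<epsilon>) = ennreal a * ennreal b + ennreal \<epsilon>" if "0 \<le> a" "0 \<le> b" for a b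
        using that assms by (simp add: ennreal_plus ennreal_mult)
      show ?thesis
        unfolding gauge_eq using s_pos by (intro gen) auto
    qed
    finally show ?thesis
      using \<eta>(1) assms by (intro that[of \<rho>]) (auto simp: \<rho>_def)
  qed
qed

text \<open>
Each covering set that meets \<open>B\<close> is replaced by a ball centred at one of its points in \<open>B\<close>.  The
losses in the radii are chosen summable with sum \<open>h\<close>.  Restricting the last estimate to finite
\<open>J\<close> keeps it an inequality between real numbers.
\<close>

lemma hausdorff_ball_cover:
  fixes B :: "'a::metric_space set"
  assumes s: "0 \<le> s" and B: "hausdorff_measure s B < ennreal h" and \<delta>: "0 < \<delta>"
  obtains I :: "nat set" and c \<rho> where "B \<subseteq> (\<Union>i\<in>I. ball (c i) (\<rho> i))"
    "\<And>i. i \<in> I \<Longrightarrow> c i \<in> B" "\<And>i. i \<in> I \<Longrightarrow> 0 < \<rho> i" "\<And>i. i \<in> I \<Longrightarrow> \<rho> i \<le> \<delta>"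
    "\<And>J. finite J \<Longrightarrow> J \<subseteq> I \<Longrightarrow> (\<Sum>i\<in>J. \<rho> i powr s) \<le> cover_const s * h"
proof -
  define K where "K = 2 powr s / unit_ball_vol s"
  have K: "0 \<le> K" using s by (simp add: K_def)
  have h: "0 < h" using B by (metis ennreal_neg not_less not_less_zero)
  obtain U :: "nat \<Rightarrow> 'a set" where U: "B \<subseteq> (\<Union>n. U n)" "\<And>n. bounded (U n)"
      "\<And>n. diameter (U n) \<le> \<delta> / 2" "(\<Sum>n. hausdorff_gauge s (U n)) < ennreal h"
    using hausdorff_cover[OF B, of "\<delta>/2"] \<delta> by auto
  define I where "I = {i. U i \<inter> B \<noteq> {}}"
  define \<epsilon> where "\<epsilon> = (\<lambda>i::nat. h * (1/2) ^ Suc i)"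
  have \<epsilon>0: "0 < \<epsilon> i" for i using h by (simp add: \<epsilon>_def)
  have "\<exists>\<rho>. diameter (U i) < \<rho> \<and> \<rho> \<le> diameter (U i) + \<delta>/2 \<and>
      ennreal (\<rho> powr s) \<le> ennreal K * hausdorff_gauge s (U i) + ennreal (\<epsilon> i)" if "i \<in> I" for i
    using ball_radius_from_gauge[OF s U(2) _ \<epsilon>0, of i "\<delta>/2" i] that \<delta>
    unfolding K_def I_def by (metis (mono_tags, lifting) half_gt_zero inf_bot_left mem_Collect_eq)
  then obtain \<rho> where \<rho>: "\<And>i. i \<in> I \<Longrightarrow> diameter (U i) < \<rho> i" "\<And>i. i \<in> I \<Longrightarrow> \<rho> i \<le> diameter (U i) + \<delta>/2"
      "\<And>i. i \<in> I \<Longrightarrow> ennreal (\<rho> i powr s) \<le> ennreal K * hausdorff_gauge s (U i) + ennreal (\<epsilon> i)"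
    by metis
  have "\<exists>c. c \<in> U i \<inter> B" if "i \<in> I" for i using that by (auto simp: I_def)
  then obtain c where c: "\<And>i. i \<in> I \<Longrightarrow> c i \<in> U i \<inter> B" by metis
  show ?thesis
  proof (rule that[where I = I and c = c and \<rho> = \<rho>])
    show "B \<subseteq> (\<Union>i\<in>I. ball (c i) (\<rho> i))"
    proof
      fix x assume x: "x \<in> B"
      then obtain i where i: "x \<in> U i" using U(1) by auto
      then have iI: "i \<in> I" using x by (auto simp: I_def)
      have "dist (c i) x \<le> diameter (U i)"
        using c[OF iI] i U(2) by (intro diameter_bounded_bound) auto
      then have "x \<in> ball (c i) (\<rho> i)"
        using \<rho>(1)[OF iI] by simp
      then show "x \<in> (\<Union>i\<in>I. ball (c i) (\<rho> i))"
        using iI by blast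
    qed
    show "c i \<in> B" if "i \<in> I" for i using c[OF that] by simp
    show "0 < \<rho> i" if "i \<in> I" for i
      using \<rho>(1)[OF that] diameter_ge_0[OF U(2)[of i]] by linarith
    show "\<rho> i \<le> \<delta>" if "i \<in> I" for i
      using \<rho>(2)[OF that] U(3)[of i] by linarith
    fix J assume J: "finite J" "J \<subseteq> I"
    have "ennreal (\<Sum>i\<in>J. \<rho> i powr s) = (\<Sum>i\<in>J. ennreal (\<rho> i powr s))"
      by simp
    also have "\<dots> \<le> (\<Sum>i\<in>J. ennreal K * hausdorff_gauge s (U i) + ennreal (\<epsilon> i))"
      using J \<rho>(3) by (intro sum_mono) auto
    also have "\<dots> = ennreal K * (\<Sum>i\<in>J. hausdorff_gauge s (U i)) + (\<Sum>i\<in>J. ennreal (\<epsilon> i))"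
      by (simp add: sum.distrib sum_distrib_left)
    also have "\<dots> \<le> ennreal K * (\<Sum>i. hausdorff_gauge s (U i)) + (\<Sum>i. ennreal (\<epsilon> i))"
      using J by (intro add_mono mult_left_mono sum_le_suminf) auto
    also have "(\<Sum>i. ennreal (\<epsilon> i)) = ennreal h"
    proof -
      have "\<epsilon> sums (h * 1)"
        unfolding \<epsilon>_def using sums_mult[OF power_half_series] by simp
      then show ?thesis
        using \<epsilon>0 by (intro suminf_ennreal_eq) (auto simp: less_imp_le)
    qed
    also have "ennreal K * (\<Sum>i. hausdorff_gauge s (U i)) + ennreal h \<le> ennreal K * ennreal h + ennreal h"
      using U(4) by (intro add_mono mult_left_mono) auto
    also have "\<dots> = ennreal (cover_const s * h)"
      using K h by (simp add: cover_const_def K_def[symmetric] algebra_simps ennreal_mult' ennreal_plus)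
    finally show "(\<Sum>i\<in>J. \<rho> i powr s) \<le> cover_const s * h"
      using K h by (subst (asm) ennreal_le_iff) (auto simp: cover_const_def K_def)
  qed
qed

text \<open>
Covering \<open>B\<close> by balls of radii at most \<open>\<delta>\<close>, one has
\<open>\<Sum>i. \<rho> i powr n \<le> \<delta> powr (n - s) * (\<Sum>i. \<rho> i powr s)\<close>, which tends to \<open>0\<close> with \<open>\<delta>\<close>.
\<close>

lemma lborel_null_of_hausdorff_finite:
  fixes B :: "'a::euclidean_space set"
  assumes s: "0 \<le> s" "s < real DIM('a)" and fin: "hausdorff_measure s B < \<infinity>" and B: "B \<in> sets borel"
  shows "emeasure lborel B = 0"
proof -
  define n where "n = real DIM('a)"
  obtain h where h: "hausdorff_measure s B < ennreal h" "0 < h"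
  proof (cases "hausdorff_measure s B")
    case (real x)
    then show ?thesis
      by (intro that[of "x + 1"]) (simp_all add: ennreal_less_iff)
  qed (use fin in simp)
  have K: "0 \<le> cover_const s" using s by (simp add: cover_const_def)
  define M where "M = unit_ball_vol n * (cover_const s * h) + 1"
  have M: "0 < M" using K h by (simp add: M_def n_def add_nonneg_pos)
  have "emeasure lborel B \<le> 0"
  proof (rule ennreal_le_epsilon)
    fix e :: real assume e: "0 < e"
    define \<delta> where "\<delta> = (e / M) powr (1 / (n - s))"
    have \<delta>: "0 < \<delta>" using e M by (simp add: \<delta>_def)
    have \<delta>_pow: "\<delta> powr (n - s) = e / M"
      using e M s by (simp add: \<delta>_def powr_powr n_def)
    obtain I :: "nat set" and c \<rho> where cov: "B \<subseteq> (\<Union>i\<in>I. ball (c i) (\<rho> i))"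
      "\<And>i. i \<in> I \<Longrightarrow> c i \<in> B" "\<And>i. i \<in> I \<Longrightarrow> 0 < \<rho> i" "\<And>i. i \<in> I \<Longrightarrow> \<rho> i \<le> \<delta>"
      "\<And>J. finite J \<Longrightarrow> J \<subseteq> I \<Longrightarrow> (\<Sum>i\<in>J. \<rho> i powr s) \<le> cover_const s * h"
      by (rule hausdorff_ball_cover[OF s(1) h(1) \<delta>]) blast
    define E where "E = (\<lambda>m. \<Union>i\<in>I \<inter> {..<m}. ball (c i) (\<rho> i))"
    have E_le: "emeasure lborel (E m) \<le> ennreal e" for m
    proof -
      have "emeasure lborel (E m) \<le> (\<Sum>i\<in>I \<inter> {..<m}. emeasure lborel (ball (c i) (\<rho> i)))"
        unfolding E_def by (intro emeasure_subadditive_finite) auto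
      also have "\<dots> = (\<Sum>i\<in>I \<inter> {..<m}. ennreal (unit_ball_vol n * \<rho> i powr n))"
        using cov(3) by (intro sum.cong refl) (auto simp: n_def emeasure_ball powr_realpow less_imp_le)
      also have "\<dots> \<le> (\<Sum>i\<in>I \<inter> {..<m}. ennreal (unit_ball_vol n * (e / M * \<rho> i powr s)))"
      proof (intro sum_mono ennreal_leI mult_left_mono)
        fix i assume i: "i \<in> I \<inter> {..<m}"
        have "\<rho> i powr n = \<rho> i powr (n - s) * \<rho> i powr s"
          by (simp add: powr_add[symmetric])
        also have "\<dots> \<le> \<delta> powr (n - s) * \<rho> i powr s"
          using i cov(3,4) s by (intro mult_right_mono powr_mono2) (auto simp: n_def less_imp_le)
        finally show "\<rho> i powr n \<le> e / M * \<rho> i powr s"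
          by (simp add: \<delta>_pow)
      qed (simp add: n_def)
      also have "\<dots> = ennreal (\<Sum>i\<in>I \<inter> {..<m}. unit_ball_vol n * (e / M * \<rho> i powr s))"
        using e M by (intro sum_ennreal) (auto simp: n_def)
      also have "\<dots> \<le> ennreal e"
      proof (rule ennreal_leI)
        have "(\<Sum>i\<in>I \<inter> {..<m}. unit_ball_vol n * (e / M * \<rho> i powr s))
            = e / M * (unit_ball_vol n * (\<Sum>i\<in>I \<inter> {..<m}. \<rho> i powr s))"
          by (simp add: sum_distrib_left mult_ac)
        also have "\<dots> \<le> e / M * (unit_ball_vol n * (cover_const s * h))"
          using e M by (intro mult_left_mono cov(5)) (auto simp: n_def)
        also have "\<dots> \<le> e / M * M"
          using e M by (intro mult_left_mono) (auto simp: M_def)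
        finally show "(\<Sum>i\<in>I \<inter> {..<m}. unit_ball_vol n * (e / M * \<rho> i powr s)) \<le> e"
          using M by simp
      qed
      finally show ?thesis .
    qed
    have E: "range E \<subseteq> sets lborel" "incseq E"
      by (force simp: E_def incseq_def)+
    have "(\<Union>i\<in>I. ball (c i) (\<rho> i)) = (\<Union>m. E m)"
      by (auto simp: E_def)
    then have "emeasure lborel B \<le> emeasure lborel (\<Union>m. E m)"
      using cov(1) E by (intro emeasure_mono) auto
    also have "\<dots> = (SUP m. emeasure lborel (E m))"
      using SUP_emeasure_incseq[OF E] by simp
    also have "\<dots> \<le> ennreal e"
      by (intro SUP_least E_le)
    finally show "emeasure lborel B \<le> 0 + ennreal e" by simp
  qed
  then show ?thesis by simp
qed

section \<open>Fields whose divergence is a nonpositive measure\<close>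

locale dissipative_field =
  fixes G :: "'a::euclidean_space set" and V :: "'a \<Rightarrow> 'a" and D :: "'a measure"
  assumes open_G: "open G"
    and locally_finite: "locally_finite_borel_measure G D"
    and divergence: "has_distributional_div G V (\<lambda>\<phi>. - (\<integral>z. \<phi> z \<partial>D))"
begin

lemma sets_D: "sets D = sets (restrict_space borel G)"
  using locally_finite by (simp add: locally_finite_borel_measure_def)

lemma space_D: "space D = G"
  using sets_eq_imp_space_eq[OF sets_D] by (simp add: space_restrict_space)

lemma in_sets_D: "A \<in> sets borel \<Longrightarrow> A \<subseteq> G \<Longrightarrow> A \<in> sets D"
  unfolding sets_D sets_restrict_space by (auto intro!: image_eqI[of _ _ A])

lemma borel_of_sets_D: "A \<in> sets D \<Longrightarrow> A \<in> sets borel"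
  using open_G unfolding sets_D sets_restrict_space by auto

lemma sets_D_subset: "A \<in> sets D \<Longrightarrow> A \<subseteq> G"
  using sets.sets_into_space[of A D] by (simp add: space_D)

lemma V_measurable: "V \<in> borel_measurable (lebesgue_on G)"
  using divergence by (simp add: has_distributional_div_def Lp_loc_def)

lemma G_lebesgue: "G \<in> sets lebesgue"
  using open_G by simp

text \<open>
Positivity of \<open>D\<close> enters here: the mass of \<open>A\<close> is at most \<open>\<integral>\<phi> dD\<close>, and the divergence equation
turns this integral into \<open>\<integral>V \<bullet> \<nabla>\<phi>\<close>.
\<close>

lemma measure_le_flux:
  fixes \<phi> :: "'a \<Rightarrow> real"
  assumes sm: "smooth_on UNIV \<phi>" and nonneg: "\<And>z. 0 \<le> \<phi> z"
    and ge1: "\<And>z. z \<in> A \<Longrightarrow> 1 \<le> \<phi> z" and A: "A \<in> sets D"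
    and supp: "{z. \<phi> z \<noteq> 0} \<subseteq> L" and L: "compact L" "L \<subseteq> G"
  shows "emeasure D A \<le> (\<integral>\<^sup>+z. ennreal (onorm (frechet_derivative \<phi> (at z)) * norm (V z)) \<partial>lebesgue_on G)"
proof -
  have closure_L: "closure {z. \<phi> z \<noteq> 0} \<subseteq> L"
    using supp L by (intro closure_minimal compact_imp_closed) auto
  then have "compact (closure {z. \<phi> z \<noteq> 0})"
    using compact_Int_closed[OF L(1), of "closure {z. \<phi> z \<noteq> 0}"] by (simp add: inf.absorb2)
  then have test: "\<phi> \<in> test_functions G"
    using sm closure_L L(2) by (simp add: test_functions_def)
  have cont: "continuous_on UNIV \<phi>"
    by (intro continuous_at_imp_continuous_on ballI)
       (rule has_derivative_continuous[OF smooth_on_has_derivative[OF sm]])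
  then have "\<phi> \<in> borel_measurable borel"
    by (rule borel_measurable_continuous_onI)
  then have meas: "\<phi> \<in> borel_measurable D"
    by (simp add: measurable_cong_sets[OF sets_D refl] measurable_restrict_space1)
  have "compact (\<phi> ` L)"
    using cont L(1) by (intro compact_continuous_image) (auto intro: continuous_on_subset)
  then obtain M where M: "\<And>z. z \<in> L \<Longrightarrow> norm (\<phi> z) \<le> M"
    by (meson bounded_iff compact_imp_bounded imageI)
  have "L \<in> sets D" using L by (intro in_sets_D borel_compact) auto
  moreover have "emeasure D L < \<infinity>"
    using locally_finite L by (simp add: locally_finite_borel_measure_def)
  ultimately have int: "integrable D \<phi>"
    using M supp meas by (intro integrableI_bounded_set[where A = L and B = M]) auto
  have "emeasure D A = (\<integral>\<^sup>+z. indicator A z \<partial>D)"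
    using A by simp
  also have "\<dots> \<le> (\<integral>\<^sup>+z. ennreal (\<phi> z) \<partial>D)"
    using ge1 by (intro nn_integral_mono) (auto simp: indicator_def)
  also have "\<dots> = ennreal (\<integral>z. \<phi> z \<partial>D)"
    using int nonneg by (intro nn_integral_eq_integral) auto
  also have "(\<integral>z. \<phi> z \<partial>D) = (\<integral>z. frechet_derivative \<phi> (at z) (V z) \<partial>lebesgue_on G)"
  proof -
    have "- (\<integral>z. frechet_derivative \<phi> (at z) (V z) \<partial>lebesgue_on G) = - (\<integral>z. \<phi> z \<partial>D)"
      using divergence test unfolding has_distributional_div_def by blast
    then show ?thesis by simp
  qed
  also have "ennreal \<dots> \<le> (\<integral>\<^sup>+z. ennreal \<bar>frechet_derivative \<phi> (at z) (V z)\<bar> \<partial>lebesgue_on G)"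
  \<comment> \<open>The Bochner integral is \<open>0\<close> by convention if the integrand is not integrable.\<close>
  proof (cases "integrable (lebesgue_on G) (\<lambda>z. frechet_derivative \<phi> (at z) (V z))")
    case True
    have "ennreal (\<integral>z. frechet_derivative \<phi> (at z) (V z) \<partial>lebesgue_on G)
        \<le> ennreal (norm (\<integral>z. frechet_derivative \<phi> (at z) (V z) \<partial>lebesgue_on G))"
      by (intro ennreal_leI) auto
    also have "\<dots> \<le> (\<integral>\<^sup>+z. ennreal (norm (frechet_derivative \<phi> (at z) (V z))) \<partial>lebesgue_on G)"
      using True by (rule integral_norm_bound_ennreal)
    finally show ?thesis by simp
  qed (simp add: not_integrable_integral_eq)
  also have "\<dots> \<le> (\<integral>\<^sup>+z. ennreal (onorm (frechet_derivative \<phi> (at z)) * norm (V z)) \<partial>lebesgue_on G)"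
  proof (intro nn_integral_mono ennreal_leI)
    fix z
    have "bounded_linear (frechet_derivative \<phi> (at z))"
      using smooth_on_has_derivative[OF sm] by (rule has_derivative_bounded_linear)
    then show "\<bar>frechet_derivative \<phi> (at z) (V z)\<bar> \<le> onorm (frechet_derivative \<phi> (at z)) * norm (V z)"
      using onorm[of "frechet_derivative \<phi> (at z)" "V z"] by simp
  qed
  finally show ?thesis .
qed

text \<open>
A doubled ball has volume of the order \<open>\<rho>\<^sup>n\<close>, which turns the gradient bound \<open>\<rho>\<^sup>-\<^sup>p\<close> into
\<open>\<rho> powr (n - p)\<close>.
\<close>

lemma nn_integral_ball_sum:
  fixes I :: "nat set" and c :: "nat \<Rightarrow> 'a" and \<rho> :: "nat \<Rightarrow> real"
  assumes "finite I" "\<And>i. i \<in> I \<Longrightarrow> 0 < \<rho> i" "\<And>i. i \<in> I \<Longrightarrow> cball (c i) (2 * \<rho> i) \<subseteq> G" "0 \<le> k"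
  shows "(\<integral>\<^sup>+z. ennreal (k * (\<Sum>i\<in>I. indicator (cball (c i) (2 * \<rho> i)) z / \<rho> i powr p)) \<partial>lebesgue_on G)
    = ennreal (k * (unit_ball_vol (real DIM('a)) * 2 ^ DIM('a)) * (\<Sum>i\<in>I. \<rho> i powr (real DIM('a) - p)))"
proof -
  have cb: "cball (c i) (2 * \<rho> i) \<in> sets (lebesgue_on G)" if "i \<in> I" for i
    using assms(3)[OF that] G_lebesgue by (simp add: sets_restrict_space_iff)
  have em: "emeasure (lebesgue_on G) (cball (c i) (2 * \<rho> i))
      = ennreal (unit_ball_vol (real DIM('a)) * (2 * \<rho> i) ^ DIM('a))" if "i \<in> I" for i
    using assms(2,3)[OF that] G_lebesgue
    by (simp add: emeasure_restrict_space emeasure_cball)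
  have "(\<integral>\<^sup>+z. ennreal (k * (\<Sum>i\<in>I. indicator (cball (c i) (2 * \<rho> i)) z / \<rho> i powr p)) \<partial>lebesgue_on G)
    = (\<integral>\<^sup>+z. (\<Sum>i\<in>I. ennreal (k / \<rho> i powr p) * indicator (cball (c i) (2 * \<rho> i)) z) \<partial>lebesgue_on G)"
  proof (intro nn_integral_cong)
    fix z
    have "ennreal (k * (\<Sum>i\<in>I. indicator (cball (c i) (2 * \<rho> i)) z / \<rho> i powr p))
        = ennreal (\<Sum>i\<in>I. k / \<rho> i powr p * indicator (cball (c i) (2 * \<rho> i)) z)"
      by (simp add: sum_distrib_left)
    also have "\<dots> = (\<Sum>i\<in>I. ennreal (k / \<rho> i powr p * indicator (cball (c i) (2 * \<rho> i)) z))"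
      using assms(4) by (intro sum_ennreal[symmetric]) auto
    also have "\<dots> = (\<Sum>i\<in>I. ennreal (k / \<rho> i powr p) * indicator (cball (c i) (2 * \<rho> i)) z)"
      by (intro sum.cong refl) (auto simp: indicator_def)
    finally show "ennreal (k * (\<Sum>i\<in>I. indicator (cball (c i) (2 * \<rho> i)) z / \<rho> i powr p)) = \<dots>" .
  qed
  also have "\<dots> = (\<Sum>i\<in>I. ennreal (k / \<rho> i powr p) * emeasure (lebesgue_on G) (cball (c i) (2 * \<rho> i)))"
    using cb by (subst nn_integral_sum) (auto simp: nn_integral_cmult_indicator)
  also have "\<dots> = (\<Sum>i\<in>I. ennreal (k * (unit_ball_vol (real DIM('a)) * 2 ^ DIM('a)) * \<rho> i powr (real DIM('a) - p)))"
  proof (intro sum.cong refl)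
    fix i assume i: "i \<in> I"
    have "ennreal (k / \<rho> i powr p) * emeasure (lebesgue_on G) (cball (c i) (2 * \<rho> i))
        = ennreal (k / \<rho> i powr p * (unit_ball_vol (real DIM('a)) * (2 * \<rho> i) ^ DIM('a)))"
      unfolding em[OF i] using assms(2)[OF i] assms(4) by (intro ennreal_mult[symmetric]) auto
    also have "k / \<rho> i powr p * (unit_ball_vol (real DIM('a)) * (2 * \<rho> i) ^ DIM('a))
        = k * (unit_ball_vol (real DIM('a)) * 2 ^ DIM('a)) * \<rho> i powr (real DIM('a) - p)"
      using assms(2)[OF i] by (simp add: powr_diff powr_realpow power_mult_distrib)
    finally show "ennreal (k / \<rho> i powr p) * emeasure (lebesgue_on G) (cball (c i) (2 * \<rho> i)) = ennreal \<dots>" .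
  qed
  also have "\<dots> = ennreal (\<Sum>i\<in>I. k * (unit_ball_vol (real DIM('a)) * 2 ^ DIM('a)) * \<rho> i powr (real DIM('a) - p))"
    using assms(4) by (intro sum_ennreal) auto
  finally show ?thesis
    by (simp add: sum_distrib_left)
qed

lemma balls_measurable:
  assumes "\<And>i. i \<in> I \<Longrightarrow> 0 < \<rho> i" "\<And>i. i \<in> I \<Longrightarrow> cball (c i) (2 * \<rho> i) \<subseteq> G"
  shows "(\<Union>i\<in>I. ball (c i) (\<rho> i)) \<in> sets D"
proof (rule in_sets_D)
  show "(\<Union>i\<in>I. ball (c i) (\<rho> i)) \<subseteq> G"
  proof safe
    fix i z assume i: "i \<in> I" and "z \<in> ball (c i) (\<rho> i)"
    then have "z \<in> cball (c i) (2 * \<rho> i)" using assms(1)[OF i] by simp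
    then show "z \<in> G" using assms(2)[OF i] by blast
  qed
qed (intro borel_open open_UN, auto)

text \<open>
For bounded \<open>V\<close> only the \<open>L\<^sup>1\<close> norm of the gradient of the cutoff enters.
\<close>

lemma finite_balls_le_bounded:
  obtains C where "0 \<le> C"
    and "\<And>(I::nat set) (c::nat \<Rightarrow> 'a) (\<rho>::nat \<Rightarrow> real) K M.
      finite I \<Longrightarrow> (\<And>i. i \<in> I \<Longrightarrow> 0 < \<rho> i) \<Longrightarrow> (\<And>i. i \<in> I \<Longrightarrow> cball (c i) (2 * \<rho> i) \<subseteq> K) \<Longrightarrow>
      compact K \<Longrightarrow> K \<subseteq> G \<Longrightarrow> 0 \<le> M \<Longrightarrow> AE z in lebesgue_on K. norm (V z) \<le> M \<Longrightarrow>
      emeasure D (\<Union>i\<in>I. ball (c i) (\<rho> i)) \<le> ennreal (C * M * (\<Sum>i\<in>I. \<rho> i powr (real DIM('a) - 1)))"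
proof -
  obtain C where C: "0 \<le> C"
    and cutoff: "\<And>(I::nat set) (c::nat \<Rightarrow> 'a) (\<rho>::nat \<Rightarrow> real). finite I \<Longrightarrow> (\<And>i. i \<in> I \<Longrightarrow> 0 < \<rho> i) \<Longrightarrow>
      \<exists>\<phi>. ball_cutoff 1 C I c \<rho> \<phi>"
    by (rule ball_family_cutoff[of 1]) (simp, blast)
  define C' where "C' = C * (unit_ball_vol (real DIM('a)) * 2 ^ DIM('a))"
  have "0 \<le> C'" using C by (simp add: C'_def)
  moreover have "emeasure D (\<Union>i\<in>I. ball (c i) (\<rho> i)) \<le> ennreal (C' * M * (\<Sum>i\<in>I. \<rho> i powr (real DIM('a) - 1)))"
    if I: "finite I" and \<rho>: "\<And>i. i \<in> I \<Longrightarrow> 0 < \<rho> i" and sub: "\<And>i. i \<in> I \<Longrightarrow> cball (c i) (2 * \<rho> i) \<subseteq> K"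
      and K: "compact K" "K \<subseteq> G" and M: "0 \<le> M" "AE z in lebesgue_on K. norm (V z) \<le> M"
    for I :: "nat set" and c :: "nat \<Rightarrow> 'a" and \<rho> :: "nat \<Rightarrow> real" and K M
  proof -
    define L where "L = (\<Union>i\<in>I. cball (c i) (2 * \<rho> i))"
    have L: "compact L" "L \<subseteq> K" using I sub by (auto simp: L_def intro!: compact_UN)
    have subG: "cball (c i) (2 * \<rho> i) \<subseteq> G" if "i \<in> I" for i
      using sub[OF that] K(2) by blast
    obtain \<phi> :: "'a \<Rightarrow> real" where sm: "smooth_on UNIV \<phi>" and \<phi>: "\<And>z. 0 \<le> \<phi> z"
        "\<And>z. z \<in> (\<Union>i\<in>I. ball (c i) (\<rho> i)) \<Longrightarrow> 1 \<le> \<phi> z" "{z. \<phi> z \<noteq> 0} \<subseteq> L"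
      and grad: "\<And>z. onorm (frechet_derivative \<phi> (at z)) powr 1
              \<le> C * (\<Sum>i\<in>I. indicator (cball (c i) (2 * \<rho> i)) z / \<rho> i powr 1)"
      using cutoff[of I \<rho> c] I \<rho> unfolding L_def ball_cutoff_def by blast
    have on0: "0 \<le> onorm (frechet_derivative \<phi> (at z))" for z
      using has_derivative_bounded_linear[OF smooth_on_has_derivative[OF sm]] by (rule onorm_pos_le)
    have K_leb: "K \<in> sets lebesgue" using K(1) by (simp add: borel_compact)
    have bound: "AE z in lebesgue_on G. z \<in> K \<longrightarrow> norm (V z) \<le> M"
      using M(2) G_lebesgue K_leb K(2) by (subst AE_restrict_space_iff) (auto simp: AE_restrict_space_iff)
    have "emeasure D (\<Union>i\<in>I. ball (c i) (\<rho> i))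
        \<le> (\<integral>\<^sup>+z. ennreal (onorm (frechet_derivative \<phi> (at z)) * norm (V z)) \<partial>lebesgue_on G)"
      using sm \<phi> balls_measurable[OF \<rho> subG] L K by (intro measure_le_flux[where L = L]) auto
    also have "\<dots> \<le> (\<integral>\<^sup>+z. ennreal (M * C * (\<Sum>i\<in>I. indicator (cball (c i) (2 * \<rho> i)) z / \<rho> i powr 1)) \<partial>lebesgue_on G)"
    proof (rule nn_integral_mono_AE, use bound in eventually_elim, rule ennreal_leI)
      fix z assume z: "z \<in> K \<longrightarrow> norm (V z) \<le> M"
      let ?S = "(\<Sum>i\<in>I. indicator (cball (c i) (2 * \<rho> i)) z / \<rho> i powr 1)"
      have gr: "onorm (frechet_derivative \<phi> (at z)) \<le> C * ?S"
        using grad[of z] on0[of z] by simp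
      show "onorm (frechet_derivative \<phi> (at z)) * norm (V z) \<le> M * C * ?S"
      proof (cases "z \<in> K")
        case True
        then have "onorm (frechet_derivative \<phi> (at z)) * norm (V z) \<le> (C * ?S) * M"
          using z gr on0[of z] by (intro mult_mono) auto
        then show ?thesis by (simp add: mult_ac)
      next
        case False
        then have "z \<notin> cball (c i) (2 * \<rho> i)" if "i \<in> I" for i
          using sub[OF that] by blast
        then have S: "?S = 0"
          by (intro sum.neutral ballI) (simp del: mem_cball)
        then show ?thesis using gr on0[of z] by simp
      qed
    qed
    also have "\<dots> = ennreal (M * C * (unit_ball_vol (real DIM('a)) * 2 ^ DIM('a)) * (\<Sum>i\<in>I. \<rho> i powr (real DIM('a) - 1)))"
      using I \<rho> subG M C by (intro nn_integral_ball_sum) auto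
    finally show ?thesis
      by (simp add: C'_def mult_ac)
  qed
  ultimately show thesis by (rule that)
qed

text \<open>
For \<open>V\<close> in \<open>L\<^sup>r\<close>, Young's inequality applied to the product of \<open>\<tau> |\<nabla>\<phi>|\<close> and \<open>|V| / \<tau>\<close> separates the
capacity of the balls from the energy of \<open>V\<close> near them.  The parameter \<open>\<tau>\<close> allows the first
summand to be made small while the sum over the radii is merely bounded.
\<close>

lemma finite_balls_le_power:
  assumes r: "1 < r" and p: "p = r / (r - 1)"
  obtains C where "0 \<le> C"
    and "\<And>(I::nat set) (c::nat \<Rightarrow> 'a) (\<rho>::nat \<Rightarrow> real) W \<tau>.
      finite I \<Longrightarrow> (\<And>i. i \<in> I \<Longrightarrow> 0 < \<rho> i) \<Longrightarrow> (\<And>i. i \<in> I \<Longrightarrow> cball (c i) (2 * \<rho> i) \<subseteq> W) \<Longrightarrow>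
      open W \<Longrightarrow> W \<subseteq> G \<Longrightarrow> 0 < \<tau> \<Longrightarrow>
      emeasure D (\<Union>i\<in>I. ball (c i) (\<rho> i)) \<le> ennreal (C * \<tau> powr p * (\<Sum>i\<in>I. \<rho> i powr (real DIM('a) - p)))
        + ennreal (1 / \<tau> powr r) * (\<integral>\<^sup>+z. ennreal (norm (V z) powr r) * indicator W z \<partial>lebesgue_on G)"
proof -
  have p1: "1 < p" using r by (simp add: p)
  have conj: "1 / p + 1 / r = 1" using r by (simp add: p divide_simps)
  obtain C where C: "0 \<le> C"
    and cutoff: "\<And>(I::nat set) (c::nat \<Rightarrow> 'a) (\<rho>::nat \<Rightarrow> real). finite I \<Longrightarrow> (\<And>i. i \<in> I \<Longrightarrow> 0 < \<rho> i) \<Longrightarrow>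
      \<exists>\<phi>. ball_cutoff p C I c \<rho> \<phi>"
    by (rule ball_family_cutoff[of p]) (use p1 in simp, blast)
  define C' where "C' = C * (unit_ball_vol (real DIM('a)) * 2 ^ DIM('a))"
  have "0 \<le> C'" using C by (simp add: C'_def)
  moreover have "emeasure D (\<Union>i\<in>I. ball (c i) (\<rho> i)) \<le> ennreal (C' * \<tau> powr p * (\<Sum>i\<in>I. \<rho> i powr (real DIM('a) - p)))
        + ennreal (1 / \<tau> powr r) * (\<integral>\<^sup>+z. ennreal (norm (V z) powr r) * indicator W z \<partial>lebesgue_on G)"
    if I: "finite I" and \<rho>: "\<And>i. i \<in> I \<Longrightarrow> 0 < \<rho> i" and sub: "\<And>i. i \<in> I \<Longrightarrow> cball (c i) (2 * \<rho> i) \<subseteq> W"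
      and W: "open W" "W \<subseteq> G" and lam: "0 < \<tau>"
    for I :: "nat set" and c :: "nat \<Rightarrow> 'a" and \<rho> :: "nat \<Rightarrow> real" and W \<tau>
  proof -
    define L where "L = (\<Union>i\<in>I. cball (c i) (2 * \<rho> i))"
    have L: "compact L" "L \<subseteq> W" using I sub by (auto simp: L_def intro!: compact_UN)
    have subG: "cball (c i) (2 * \<rho> i) \<subseteq> G" if "i \<in> I" for i
      using sub[OF that] W(2) by blast
    obtain \<phi> :: "'a \<Rightarrow> real" where sm: "smooth_on UNIV \<phi>" and \<phi>: "\<And>z. 0 \<le> \<phi> z"
        "\<And>z. z \<in> (\<Union>i\<in>I. ball (c i) (\<rho> i)) \<Longrightarrow> 1 \<le> \<phi> z" "{z. \<phi> z \<noteq> 0} \<subseteq> L"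
      and grad: "\<And>z. onorm (frechet_derivative \<phi> (at z)) powr p
              \<le> C * (\<Sum>i\<in>I. indicator (cball (c i) (2 * \<rho> i)) z / \<rho> i powr p)"
      using cutoff[of I \<rho> c] I \<rho> unfolding L_def ball_cutoff_def by blast
    have on0: "0 \<le> onorm (frechet_derivative \<phi> (at z))" for z
      using has_derivative_bounded_linear[OF smooth_on_has_derivative[OF sm]] by (rule onorm_pos_le)
    let ?S = "\<lambda>z. (\<Sum>i\<in>I. indicator (cball (c i) (2 * \<rho> i)) z / \<rho> i powr p) :: real"
    have S0: "0 \<le> ?S z" for z by (intro sum_nonneg) auto
    have ptw: "ennreal (onorm (frechet_derivative \<phi> (at z)) * norm (V z))
       \<le> ennreal (\<tau> powr p * C * ?S z) + ennreal (1 / \<tau> powr r) * (ennreal (norm (V z) powr r) * indicator W z)" for z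
    proof (cases "z \<in> W")
      case True
      let ?a = "onorm (frechet_derivative \<phi> (at z))" and ?b = "norm (V z)"
      have "(\<tau> * ?a) * (?b / \<tau>) \<le> (\<tau> * ?a) powr p / p + (?b / \<tau>) powr r / r"
        using p1 r conj lam on0 by (intro Youngs_inequality) auto
      also have "\<dots> \<le> (\<tau> * ?a) powr p + (?b / \<tau>) powr r"
        using p1 r by (intro add_mono) (auto simp: pos_divide_le_eq mult_le_cancel_left1)
      also have "\<dots> = \<tau> powr p * ?a powr p + 1 / \<tau> powr r * ?b powr r"
        using lam on0 by (simp add: powr_mult powr_divide)
      also have "\<dots> \<le> \<tau> powr p * (C * ?S z) + 1 / \<tau> powr r * ?b powr r"
        using grad by (intro add_right_mono mult_left_mono) auto
      finally have "?a * ?b \<le> \<tau> powr p * C * ?S z + 1 / \<tau> powr r * ?b powr r"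
        using lam by simp
      then have "ennreal (?a * ?b) \<le> ennreal (\<tau> powr p * C * ?S z + 1 / \<tau> powr r * ?b powr r)"
        by (rule ennreal_leI)
      also have "\<dots> = ennreal (\<tau> powr p * C * ?S z) + ennreal (1 / \<tau> powr r) * ennreal (?b powr r)"
      proof -
        have "0 \<le> \<tau> powr p * C * ?S z"
          using C S0[of z] by (intro mult_nonneg_nonneg) auto
        moreover have "ennreal (1 / \<tau> powr r * ?b powr r) = ennreal (1 / \<tau> powr r) * ennreal (?b powr r)"
          by (rule ennreal_mult) auto
        ultimately show ?thesis
          by (subst ennreal_plus) auto
      qed
      finally show ?thesis using True by simp
    next
      case False
      then have "z \<notin> cball (c i) (2 * \<rho> i)" if "i \<in> I" for i
        using sub[OF that] by blast
      then have "?S z = 0"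
        by (intro sum.neutral ballI) (simp del: mem_cball)
      then have "onorm (frechet_derivative \<phi> (at z)) = 0"
        using grad[of z] on0[of z] p1 by simp
      then show ?thesis by simp
    qed
    have W_meas: "W \<in> sets (lebesgue_on G)"
      using W G_lebesgue by (simp add: sets_restrict_space_iff)
    have cb_meas: "cball (c i) (2 * \<rho> i) \<in> sets (lebesgue_on G)" if "i \<in> I" for i
      using subG[OF that] G_lebesgue by (simp add: sets_restrict_space_iff)
    have m2: "(\<lambda>z. ennreal (norm (V z) powr r) * indicator W z) \<in> borel_measurable (lebesgue_on G)"
      
    proof -
      have "(\<lambda>z. norm (V z) powr r) \<in> borel_measurable (lebesgue_on G)"
        using V_measurable by simp
      then show ?thesis
        using W_meas by simp
    qed
    have m1: "(\<lambda>z. ennreal (\<tau> powr p * C * ?S z)) \<in> borel_measurable (lebesgue_on G)"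
    proof -
      have "(\<lambda>z. indicator (cball (c i) (2 * \<rho> i)) z / \<rho> i powr p :: real) \<in> borel_measurable (lebesgue_on G)" if "i \<in> I" for i
        by (intro borel_measurable_divide borel_measurable_indicator cb_meas[OF that]) simp
      then have "?S \<in> borel_measurable (lebesgue_on G)"
        by (rule borel_measurable_sum)
      then show ?thesis by simp
    qed
    have "emeasure D (\<Union>i\<in>I. ball (c i) (\<rho> i))
        \<le> (\<integral>\<^sup>+z. ennreal (onorm (frechet_derivative \<phi> (at z)) * norm (V z)) \<partial>lebesgue_on G)"
      using sm \<phi> balls_measurable[OF \<rho> subG] L W by (intro measure_le_flux[where L = L]) auto
    also have "\<dots> \<le> (\<integral>\<^sup>+z. ennreal (\<tau> powr p * C * ?S z)
        + ennreal (1 / \<tau> powr r) * (ennreal (norm (V z) powr r) * indicator W z) \<partial>lebesgue_on G)"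
      by (intro nn_integral_mono ptw)
    also have "\<dots> = (\<integral>\<^sup>+z. ennreal (\<tau> powr p * C * ?S z) \<partial>lebesgue_on G)
        + ennreal (1 / \<tau> powr r) * (\<integral>\<^sup>+z. ennreal (norm (V z) powr r) * indicator W z \<partial>lebesgue_on G)"
      unfolding nn_integral_cmult[OF m2, symmetric]
      by (rule nn_integral_add[OF m1 borel_measurable_times_ennreal[OF borel_measurable_const m2]])
    also have "(\<integral>\<^sup>+z. ennreal (\<tau> powr p * C * ?S z) \<partial>lebesgue_on G)
        = ennreal (\<tau> powr p * C * (unit_ball_vol (real DIM('a)) * 2 ^ DIM('a)) * (\<Sum>i\<in>I. \<rho> i powr (real DIM('a) - p)))"
      using I \<rho> subG C by (intro nn_integral_ball_sum) auto
    finally show ?thesis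
      by (simp add: C'_def mult_ac)
  qed
  ultimately show thesis by (rule that)
qed

section \<open>Null sets and dimension\<close>

text \<open>
An estimate for finite families of balls inside \<open>W\<close> passes to a set \<open>B\<close> in \<open>W\<close>.  The doubled balls
of a covering stay inside \<open>W\<close> only if the centres keep a distance from its boundary, so \<open>B\<close> is
exhausted by its intersections with the closed sets \<open>F k\<close> of points at distance at least
\<open>1 / (k + 1)\<close> from the complement of \<open>W\<close>.  Continuity from below handles both the countable
coverings and the exhaustion.
\<close>

lemma measure_le_of_ball_estimate:
  assumes W: "open W" "W \<subseteq> G" and B: "B \<in> sets borel" "B \<subseteq> W"
    and s: "0 \<le> s" and h: "hausdorff_measure s B < ennreal h" and a: "0 \<le> a"
    and est: "\<And>(I::nat set) c \<rho>. finite I \<Longrightarrow> (\<And>i. i \<in> I \<Longrightarrow> 0 < \<rho> i) \<Longrightarrow>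
      (\<And>i. i \<in> I \<Longrightarrow> cball (c i) (2 * \<rho> i) \<subseteq> W) \<Longrightarrow>
      emeasure D (\<Union>i\<in>I. ball (c i) (\<rho> i)) \<le> ennreal (a * (\<Sum>i\<in>I. \<rho> i powr s) + b)"
  shows "emeasure D B \<le> ennreal (a * (cover_const s * h) + b)"
proof -
  define F where "F = (\<lambda>k::nat. {x. \<forall>y\<in>-W. 1 / real (Suc k) \<le> dist x y})"
  have F_closed: "closed (F k)" for k
  proof -
    have "F k = (\<Inter>y\<in>-W. {x. 1 / real (Suc k) \<le> dist x y})"
      by (auto simp: F_def)
    then show ?thesis
      by (auto intro!: closed_INT closed_Collect_le continuous_intros)
  qed
  have F_mono: "F k \<subseteq> F m" if "k \<le> m" for k m
  proof
    fix x assume x: "x \<in> F k"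
    have "1 / real (Suc m) \<le> 1 / real (Suc k)"
      using that by (intro divide_left_mono) auto
    then show "x \<in> F m" using x unfolding F_def by (auto intro: order_trans)
  qed
  have cover_F: "B = (\<Union>k. B \<inter> F k)"
  proof -
    have "\<exists>k. x \<in> F k" if x: "x \<in> B" for x
    proof -
      obtain e where e: "0 < e" "ball x e \<subseteq> W"
        using W(1) B(2) x by (meson openE subsetD)
      obtain k :: nat where k: "1 / real (Suc k) < e"
        using e(1) nat_approx_posE by blast
      have "1 / real (Suc k) \<le> dist x y" if "y \<in> -W" for y
        using that e(2) k by (smt (verit) ComplD mem_ball subsetD)
      then show ?thesis unfolding F_def by blast
    qed
    then show ?thesis by auto
  qed
  have Bk: "emeasure D (B \<inter> F k) \<le> ennreal (a * (cover_const s * h) + b)" for k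
  proof -
    define \<delta> where "\<delta> = 1 / (3 * real (Suc k))"
    have \<delta>: "0 < \<delta>" "2 * \<delta> < 1 / real (Suc k)" by (auto simp: \<delta>_def field_simps)
    have "hausdorff_measure s (B \<inter> F k) < ennreal h"
      using hausdorff_measure_mono[of "B \<inter> F k" B s] h by auto
    then obtain I :: "nat set" and c \<rho> where cov: "B \<inter> F k \<subseteq> (\<Union>i\<in>I. ball (c i) (\<rho> i))"
      "\<And>i. i \<in> I \<Longrightarrow> c i \<in> B \<inter> F k" "\<And>i. i \<in> I \<Longrightarrow> 0 < \<rho> i" "\<And>i. i \<in> I \<Longrightarrow> \<rho> i \<le> \<delta>"
      "\<And>J. finite J \<Longrightarrow> J \<subseteq> I \<Longrightarrow> (\<Sum>i\<in>J. \<rho> i powr s) \<le> cover_const s * h"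
      by (rule hausdorff_ball_cover[OF s _ \<delta>(1)]) blast
    have sub: "cball (c i) (2 * \<rho> i) \<subseteq> W" if "i \<in> I" for i
    proof
      fix y assume "y \<in> cball (c i) (2 * \<rho> i)"
      then have "dist (c i) y \<le> 2 * \<delta>" using cov(4)[OF that] by simp
      then have "\<not> 1 / real (Suc k) \<le> dist (c i) y" using \<delta>(2) by linarith
      then show "y \<in> W" using cov(2)[OF that] unfolding F_def by blast
    qed
    define E where "E = (\<lambda>m. \<Union>i\<in>I \<inter> {..<m}. ball (c i) (\<rho> i))"
    have E_le: "emeasure D (E m) \<le> ennreal (a * (cover_const s * h) + b)" for m
    proof -
      have "emeasure D (E m) \<le> ennreal (a * (\<Sum>i\<in>I \<inter> {..<m}. \<rho> i powr s) + b)"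
        unfolding E_def using cov(3) sub by (intro est) auto
      also have "\<dots> \<le> ennreal (a * (cover_const s * h) + b)"
        using a by (intro ennreal_leI add_right_mono mult_left_mono cov(5)) auto
      finally show ?thesis .
    qed
    have "E m \<in> sets D" for m
      unfolding E_def
    proof (rule balls_measurable)
      fix i assume i: "i \<in> I \<inter> {..<m}"
      show "0 < \<rho> i" using i cov(3) by blast
      show "cball (c i) (2 * \<rho> i) \<subseteq> G" using sub[of i] i W(2) by blast
    qed
    then have E: "range E \<subseteq> sets D" "incseq E"
      by (blast, force simp: E_def incseq_def)
    have "(\<Union>i\<in>I. ball (c i) (\<rho> i)) = (\<Union>m. E m)"
      by (auto simp: E_def)
    then have "emeasure D (B \<inter> F k) \<le> emeasure D (\<Union>m. E m)"
      using cov(1) E by (intro emeasure_mono) auto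
    also have "\<dots> = (SUP m. emeasure D (E m))"
      using SUP_emeasure_incseq[OF E] by simp
    also have "\<dots> \<le> ennreal (a * (cover_const s * h) + b)"
      by (intro SUP_least E_le)
    finally show ?thesis .
  qed
  have "B \<inter> F k \<in> sets D" for k
    using B W(2) F_closed by (intro in_sets_D) auto
  then have "range (\<lambda>k. B \<inter> F k) \<subseteq> sets D" "incseq (\<lambda>k. B \<inter> F k)"
    using F_mono by (auto simp: incseq_def)
  then have "emeasure D (\<Union>k. B \<inter> F k) = (SUP k. emeasure D (B \<inter> F k))"
    by (rule SUP_emeasure_incseq[symmetric])
  then have "emeasure D B = (SUP k. emeasure D (B \<inter> F k))"
    using cover_F by simp
  also have "\<dots> \<le> ennreal (a * (cover_const s * h) + b)"
    by (intro SUP_least Bk)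
  finally show ?thesis .
qed

lemma compact_neighbourhood:
  assumes "compact K" "K \<subseteq> G"
  obtains L where "compact L" "L \<subseteq> G" "K \<subseteq> interior L"
proof (rule open_Union_compact_subsets[OF open_G])
  fix C :: "nat \<Rightarrow> 'a set"
  assume C: "\<And>n. compact (C n)" "\<And>n. C n \<subseteq> G" "\<And>n. C n \<subseteq> interior (C (Suc n))"
    and absorb: "\<And>K. \<lbrakk>compact K; K \<subseteq> G\<rbrakk> \<Longrightarrow> \<exists>N. \<forall>n\<ge>N. K \<subseteq> C n"
  obtain N where "\<forall>n\<ge>N. K \<subseteq> C n"
    using absorb[OF assms] by (rule exE)
  then have "K \<subseteq> C N" by simp
  then have "K \<subseteq> interior (C (Suc N))"
    using C(3) by (rule subset_trans)
  then show thesis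
    by (rule that[OF C(1) C(2)])
qed

text \<open>
Outer regularity of the finite measure \<open>|V|\<^sup>r dz\<close> on \<open>K\<close>, transported to the Borel sets of the whole
space.
\<close>

lemma small_energy_neighbourhood:
  assumes K: "compact K" "K \<subseteq> G" and int: "integrable (lebesgue_on K) (\<lambda>z. norm (V z) powr r)"
    and B: "B \<in> sets borel" "emeasure lborel B = 0" "B \<subseteq> interior K" and e: "0 < (e::real)"
  obtains W where "open W" "B \<subseteq> W" "W \<subseteq> K"
    "(\<integral>\<^sup>+z. ennreal (norm (V z) powr r) * indicator W z \<partial>lebesgue_on G) \<le> ennreal e"
proof -
  define g where "g = (\<lambda>z. ennreal (norm (V z) powr r))"
  define M where "M = distr (density (lebesgue_on K) g) borel (\<lambda>z. z)"
  have K_leb: "K \<in> sets lebesgue" using K by (simp add: borel_compact)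
  have g: "g \<in> borel_measurable (lebesgue_on K)"
    using borel_measurable_integrable[OF int] by (simp add: g_def)
  have id: "(\<lambda>z. z) \<in> density (lebesgue_on K) g \<rightarrow>\<^sub>M borel"
  proof -
    have "(\<lambda>z. z) \<in> lebesgue_on K \<rightarrow>\<^sub>M borel"
      by (intro measurable_restrict_space1 measurable_completion) simp
    then show ?thesis
      by (simp only: measurable_cong_sets[OF sets_density refl])
  qed
  have A_meas: "A \<inter> K \<in> sets (lebesgue_on K)" if "A \<in> sets borel" for A
  proof -
    have "A \<inter> K \<in> sets borel"
      using that borel_compact[OF K(1)] by (rule sets.Int)
    then show ?thesis
      using K_leb by (simp add: sets_restrict_space_iff)
  qed
  have M_eq: "emeasure M A = (\<integral>\<^sup>+z. g z * indicator A z \<partial>lebesgue_on K)" if A: "A \<in> sets borel" for A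
  proof -
    have "emeasure M A = emeasure (density (lebesgue_on K) g) (A \<inter> K)"
      unfolding M_def using A id by (subst emeasure_distr) (auto simp: space_restrict_space)
    also have "\<dots> = (\<integral>\<^sup>+z. g z * indicator (A \<inter> K) z \<partial>lebesgue_on K)"
      by (rule emeasure_density[OF g A_meas[OF A]])
    also have "\<dots> = (\<integral>\<^sup>+z. g z * indicator A z \<partial>lebesgue_on K)"
      by (intro nn_integral_cong) (auto simp: space_restrict_space indicator_def)
    finally show ?thesis .
  qed
  have sets_M: "sets M = sets borel" by (simp add: M_def)
  have space_M: "space M = UNIV" by (simp add: M_def)
  have "emeasure M (space M) = (\<integral>\<^sup>+z. ennreal (norm (norm (V z) powr r)) \<partial>lebesgue_on K)"
    unfolding space_M by (subst M_eq) (auto simp: g_def)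
  then have finite_M: "emeasure M (space M) \<noteq> \<infinity>"
    using int by (simp add: integrable_iff_bounded less_top)
  have "B \<inter> K \<in> null_sets (lebesgue_on K)"
  proof -
    have "emeasure (lebesgue_on K) (B \<inter> K) = emeasure lebesgue (B \<inter> K)"
      using K_leb by (intro emeasure_restrict_space) auto
    also have "\<dots> \<le> emeasure lebesgue B"
      using B by (intro emeasure_mono) auto
    also have "\<dots> = 0" using B by simp
    finally show ?thesis using A_meas[OF B(1)] by (intro null_setsI) auto
  qed
  then have "AE z in lebesgue_on K. z \<notin> B \<inter> K"
    by (rule AE_not_in)
  moreover have "AE z in lebesgue_on K. z \<in> K"
    by (intro AE_I2) (simp add: space_restrict_space)
  ultimately have "AE z in lebesgue_on K. g z * indicator B z = 0"
    by eventually_elim (auto simp: indicator_def)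
  then have "(\<integral>\<^sup>+z. g z * indicator B z \<partial>lebesgue_on K) = (\<integral>\<^sup>+z. 0 \<partial>lebesgue_on K)"
    by (rule nn_integral_cong_AE)
  then have "emeasure M B = 0" using M_eq[OF B(1)] by simp
  then have "Inf (emeasure M ` {U. B \<subseteq> U \<and> open U}) < ennreal e"
    using outer_regular[OF sets_M finite_M B(1)] e by simp
  then obtain U where U: "B \<subseteq> U" "open U" "emeasure M U < ennreal e"
    unfolding Inf_less_iff by blast
  define W where "W = U \<inter> interior K"
  have "(\<integral>\<^sup>+z. g z * indicator W z \<partial>lebesgue_on G) = (\<integral>\<^sup>+z. g z * indicator W z * indicator G z \<partial>lebesgue)"
    using G_lebesgue by (intro nn_integral_restrict_space) auto
  also have "\<dots> \<le> (\<integral>\<^sup>+z. g z * indicator U z * indicator K z \<partial>lebesgue)"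
    using interior_subset[of K] by (intro nn_integral_mono) (auto simp: W_def indicator_def)
  also have "\<dots> = (\<integral>\<^sup>+z. g z * indicator U z \<partial>lebesgue_on K)"
    using K_leb by (intro nn_integral_restrict_space[symmetric]) auto
  also have "\<dots> = emeasure M U"
    using U(2) by (intro M_eq[symmetric]) auto
  finally have "(\<integral>\<^sup>+z. g z * indicator W z \<partial>lebesgue_on G) \<le> ennreal e"
    using U(3) by auto
  moreover have "open W" "B \<subseteq> W" "W \<subseteq> K"
    using U B(3) interior_subset[of K] by (auto simp: W_def)
  ultimately show ?thesis
    unfolding g_def by (intro that[of W])
qed

text \<open>
Given \<open>\<epsilon>\<close>, the weight \<open>\<tau>\<close> is chosen so that the capacity term is at most \<open>\<epsilon> / 2\<close>, and then \<open>W\<close> so that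
the energy term is at most \<open>\<epsilon> / 2\<close>.
\<close>

theorem null_of_hausdorff_finite:
  assumes r: "1 < r" and V: "Lp_loc (ereal r) G V"
    and s: "s = real DIM('a) - r / (r - 1)" "0 \<le> s"
    and B: "B \<in> sets borel" "B \<subset>\<subset> G" "hausdorff_measure s B < \<infinity>"
  shows "emeasure D B = 0"
proof -
  define p where "p = r / (r - 1)"
  have p: "1 < p" using r by (simp add: p_def)
  have sp: "real DIM('a) - p = s" by (simp add: s p_def)
  have "compact (closure B)" "closure B \<subseteq> G"
    using B(2) by (auto simp: compactly_contained_def)
  then obtain K where K: "compact K" "K \<subseteq> G" "closure B \<subseteq> interior K"
    by (rule compact_neighbourhood)
  have BK: "B \<subseteq> interior K" using K(3) closure_subset by blast
  have int: "integrable (lebesgue_on K) (\<lambda>z. norm (V z) powr r)"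
    using V K by (auto simp: Lp_loc_def)
  have null: "emeasure lborel B = 0"
    using B(1,3) s p by (intro lborel_null_of_hausdorff_finite[of s]) (auto simp: p_def)
  obtain h where h: "hausdorff_measure s B < ennreal h" "0 < h"
  proof (cases "hausdorff_measure s B")
    case (real x)
    then show ?thesis
      by (intro that[of "x + 1"]) (simp_all add: ennreal_less_iff)
  qed (use B(3) in simp)
  obtain C where C: "0 \<le> C"
    and est: "\<And>(I::nat set) (c::nat \<Rightarrow> 'a) (\<rho>::nat \<Rightarrow> real) W \<tau>.
      finite I \<Longrightarrow> (\<And>i. i \<in> I \<Longrightarrow> 0 < \<rho> i) \<Longrightarrow> (\<And>i. i \<in> I \<Longrightarrow> cball (c i) (2 * \<rho> i) \<subseteq> W) \<Longrightarrow>
      open W \<Longrightarrow> W \<subseteq> G \<Longrightarrow> 0 < \<tau> \<Longrightarrow>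
      emeasure D (\<Union>i\<in>I. ball (c i) (\<rho> i)) \<le> ennreal (C * \<tau> powr p * (\<Sum>i\<in>I. \<rho> i powr s))
        + ennreal (1 / \<tau> powr r) * (\<integral>\<^sup>+z. ennreal (norm (V z) powr r) * indicator W z \<partial>lebesgue_on G)"
    by (rule finite_balls_le_power[OF r p_def, unfolded sp]) blast
  define H where "H = cover_const s * h"
  have H: "0 \<le> H" using s(2) h(2) by (simp add: H_def cover_const_def)
  have "emeasure D B \<le> 0"
  proof (rule ennreal_le_epsilon)
    fix \<epsilon> :: real assume \<epsilon>: "0 < \<epsilon>"
    define \<tau> where "\<tau> = (\<epsilon> / (2 * (C * H + 1))) powr (1 / p)"
    have CH: "0 < C * H + 1" using C H by (simp add: add_nonneg_pos)
    have \<tau>: "0 < \<tau>" using \<epsilon> CH by (simp add: \<tau>_def)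
    have \<tau>p: "\<tau> powr p = \<epsilon> / (2 * (C * H + 1))"
      using \<epsilon> CH p by (simp add: \<tau>_def powr_powr)
    define e where "e = \<epsilon> / 2 * \<tau> powr r"
    have "0 < e" using \<epsilon> \<tau> by (simp add: e_def)
    then obtain W where W: "open W" "B \<subseteq> W" "W \<subseteq> K"
      and small: "(\<integral>\<^sup>+z. ennreal (norm (V z) powr r) * indicator W z \<partial>lebesgue_on G) \<le> ennreal e"
      by (rule small_energy_neighbourhood[OF K(1,2) int B(1) null BK])
    have WG: "W \<subseteq> G" using W K by blast
    have "emeasure D B \<le> ennreal (C * \<tau> powr p * (cover_const s * h) + \<epsilon> / 2)"
    proof (rule measure_le_of_ball_estimate[OF W(1) WG B(1) W(2) s(2) h(1)])
      show "0 \<le> C * \<tau> powr p" using C by simp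
      fix I :: "nat set" and c :: "nat \<Rightarrow> 'a" and \<rho> :: "nat \<Rightarrow> real"
      assume I: "finite I" "\<And>i. i \<in> I \<Longrightarrow> 0 < \<rho> i" "\<And>i. i \<in> I \<Longrightarrow> cball (c i) (2 * \<rho> i) \<subseteq> W"
      have "emeasure D (\<Union>i\<in>I. ball (c i) (\<rho> i)) \<le> ennreal (C * \<tau> powr p * (\<Sum>i\<in>I. \<rho> i powr s))
        + ennreal (1 / \<tau> powr r) * (\<integral>\<^sup>+z. ennreal (norm (V z) powr r) * indicator W z \<partial>lebesgue_on G)"
        using I W(1) WG \<tau> by (intro est) auto
      also have "\<dots> \<le> ennreal (C * \<tau> powr p * (\<Sum>i\<in>I. \<rho> i powr s)) + ennreal (1 / \<tau> powr r) * ennreal e"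
        using small by (intro add_left_mono mult_left_mono) auto
      also have "ennreal (1 / \<tau> powr r) * ennreal e = ennreal (\<epsilon> / 2)"
        using \<tau> \<epsilon> by (subst ennreal_mult[symmetric]) (auto simp: e_def)
      also have "ennreal (C * \<tau> powr p * (\<Sum>i\<in>I. \<rho> i powr s)) + ennreal (\<epsilon> / 2)
          = ennreal (C * \<tau> powr p * (\<Sum>i\<in>I. \<rho> i powr s) + \<epsilon> / 2)"
        using C \<epsilon> by (intro ennreal_plus[symmetric] mult_nonneg_nonneg sum_nonneg) auto
      finally show "emeasure D (\<Union>i\<in>I. ball (c i) (\<rho> i)) \<le> \<dots>" .
    qed
    also have "\<dots> \<le> ennreal \<epsilon>"
    proof (rule ennreal_leI)
      have "C * \<tau> powr p * (cover_const s * h) = \<epsilon> / 2 * (C * H / (C * H + 1))"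
        by (simp add: \<tau>p H_def)
      also have "\<dots> \<le> \<epsilon> / 2 * 1"
        using \<epsilon> CH by (intro mult_left_mono) (auto simp: pos_divide_le_eq)
      finally show "C * \<tau> powr p * (cover_const s * h) + \<epsilon> / 2 \<le> \<epsilon>" by simp
    qed
    finally show "emeasure D B \<le> 0 + ennreal \<epsilon>" by simp
  qed
  then show ?thesis by simp
qed

text \<open>
The set \<open>G\<close> is a countable union of compact subsets.
\<close>

lemma null_of_null_on_compactly_contained:
  assumes A: "A \<in> sets D" and null: "\<And>B. B \<in> sets borel \<Longrightarrow> B \<subseteq> A \<Longrightarrow> B \<subset>\<subset> G \<Longrightarrow> emeasure D B = 0"
  shows "emeasure D A = 0"
proof -
  obtain C where C: "\<And>n. compact (C n)" "\<And>n::nat. C n \<subseteq> G" "\<Union>(range C) = G"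
    by (rule open_Union_compact_subsets[OF open_G]) blast
  have "A \<inter> C n \<in> null_sets D" for n
  proof -
    have closed_C: "closed (C n)" using C(1) by (rule compact_imp_closed)
    have sub: "closure (A \<inter> C n) \<subseteq> C n"
      using closed_C by (intro closure_minimal) auto
    then have "compact (closure (A \<inter> C n))"
      using compact_Int_closed[OF C(1), of "closure (A \<inter> C n)" n] by (simp add: inf.absorb2)
    then have "A \<inter> C n \<subset>\<subset> G"
      using sub C(2) by (auto simp: compactly_contained_def)
    moreover have meas: "A \<inter> C n \<in> sets borel"
      using borel_of_sets_D[OF A] borel_closed[OF closed_C] by (rule sets.Int)
    ultimately have "emeasure D (A \<inter> C n) = 0"
      by (intro null) auto
    moreover have "A \<inter> C n \<in> sets D"
      using meas sets_D_subset[OF A] by (intro in_sets_D) auto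
    ultimately show ?thesis
      by (rule null_setsI)
  qed
  then have "(\<Union>n. A \<inter> C n) \<in> null_sets D"
    by (rule null_sets_UN)
  moreover have "(\<Union>n. A \<inter> C n) = A"
    using C(3) sets_D_subset[OF A] by auto
  ultimately show ?thesis by auto
qed

text \<open>
In the bounded case the measure of \<open>B\<close> is at most a multiple of \<open>\<Sum>i. \<rho> i powr (n - 1)\<close>, which is
arbitrarily small for coverings of an \<open>H\<^sup>n\<^sup>-\<^sup>1\<close>-null set.
\<close>

theorem null_of_hausdorff_null_bounded:
  assumes V: "Lp_loc \<infinity> G V" and A: "A \<in> sets D" "hausdorff_measure (real DIM('a) - 1) A = 0"
  shows "emeasure D A = 0"
proof (rule null_of_null_on_compactly_contained[OF A(1)])
  define s where "s = real DIM('a) - 1"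
  have "1 \<le> DIM('a)" using DIM_positive[where 'a='a] by linarith
  then have s: "0 \<le> s" by (simp add: s_def)
  fix B assume B: "B \<in> sets borel" "B \<subseteq> A" "B \<subset>\<subset> G"
  have "compact (closure B)" "closure B \<subseteq> G"
    using B(3) by (auto simp: compactly_contained_def)
  then obtain K where K: "compact K" "K \<subseteq> G" "closure B \<subseteq> interior K"
    by (rule compact_neighbourhood)
  have BK: "B \<subseteq> interior K" using K(3) closure_subset by blast
  obtain M0 where "AE z in lebesgue_on K. norm (V z) \<le> M0"
    using V K by (auto simp: Lp_loc_def)
  then have M: "AE z in lebesgue_on K. norm (V z) \<le> max M0 0"
    by eventually_elim simp
  obtain C where C: "0 \<le> C" and est: "\<And>(I::nat set) (c::nat \<Rightarrow> 'a) (\<rho>::nat \<Rightarrow> real) K M.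
      finite I \<Longrightarrow> (\<And>i. i \<in> I \<Longrightarrow> 0 < \<rho> i) \<Longrightarrow> (\<And>i. i \<in> I \<Longrightarrow> cball (c i) (2 * \<rho> i) \<subseteq> K) \<Longrightarrow>
      compact K \<Longrightarrow> K \<subseteq> G \<Longrightarrow> 0 \<le> M \<Longrightarrow> AE z in lebesgue_on K. norm (V z) \<le> M \<Longrightarrow>
      emeasure D (\<Union>i\<in>I. ball (c i) (\<rho> i)) \<le> ennreal (C * M * (\<Sum>i\<in>I. \<rho> i powr s))"
    by (rule finite_balls_le_bounded[folded s_def]) blast
  define a where "a = C * max M0 0"
  have a: "0 \<le> a" using C by (simp add: a_def)
  have K0: "0 < cover_const s" using s by (simp add: cover_const_def add_nonneg_pos)
  have "emeasure D B \<le> 0"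
  proof (rule ennreal_le_epsilon)
    fix \<epsilon> :: real assume \<epsilon>: "0 < \<epsilon>"
    define h where "h = \<epsilon> / ((a + 1) * cover_const s)"
    have h: "0 < h" using \<epsilon> a K0 by (simp add: h_def)
    have "hausdorff_measure s B \<le> 0"
      using hausdorff_measure_mono[OF B(2), of s] A(2) by (simp add: s_def)
    then have less: "hausdorff_measure s B < ennreal h"
      using h by simp
    have "emeasure D B \<le> ennreal (a * (cover_const s * h) + 0)"
    proof (rule measure_le_of_ball_estimate[OF open_interior _ B(1) BK s less a])
      show "interior K \<subseteq> G" using K(2) interior_subset by blast
      fix I :: "nat set" and c :: "nat \<Rightarrow> 'a" and \<rho> :: "nat \<Rightarrow> real"
      assume I: "finite I" "\<And>i. i \<in> I \<Longrightarrow> 0 < \<rho> i" "\<And>i. i \<in> I \<Longrightarrow> cball (c i) (2 * \<rho> i) \<subseteq> interior K"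
      have "cball (c i) (2 * \<rho> i) \<subseteq> K" if "i \<in> I" for i
        using I(3)[OF that] interior_subset by blast
      then show "emeasure D (\<Union>i\<in>I. ball (c i) (\<rho> i)) \<le> ennreal (a * (\<Sum>i\<in>I. \<rho> i powr s) + 0)"
        unfolding a_def add_0_right using I(1,2) K(1,2) M by (intro est) auto
    qed
    also have "a * (cover_const s * h) + 0 = \<epsilon> * (a / (a + 1))"
      using K0 by (simp add: h_def)
    also have "ennreal \<dots> \<le> ennreal (\<epsilon> * 1)"
      using a \<epsilon> by (intro ennreal_leI mult_left_mono) auto
    finally show "emeasure D B \<le> 0 + ennreal \<epsilon>" by simp
  qed
  then show "emeasure D B = 0" by simp
qed

text \<open>
A dimension below \<open>s\<close> would give \<open>H\<^sup>t S = 0\<close> for some \<open>t < s\<close>, hence \<open>H\<^sup>s S = 0\<close>, and \<open>D\<close> would vanish on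
\<open>S\<close>.
\<close>

theorem dimension_of_concentration_set:
  assumes null: "\<And>B. B \<in> sets borel \<Longrightarrow> B \<subset>\<subset> G \<Longrightarrow> hausdorff_measure s B = 0 \<Longrightarrow> emeasure D B = 0"
    and nontrivial: "emeasure D (space D) \<noteq> 0" and S: "concentrated_on D S"
  shows "ereal s \<le> hausdorff_dim S"
proof (rule ccontr)
  assume "\<not> ereal s \<le> hausdorff_dim S"
  then obtain t where t: "0 \<le> t" "hausdorff_measure t S = 0" "t < s"
    unfolding hausdorff_dim_def not_le Inf_less_iff by auto
  have S_null: "hausdorff_measure s S = 0"
    using t by (intro hausdorff_measure_eq_0_mono[of t s S])
  have S_meas: "G \<inter> S \<in> sets D"
    using S open_G by (intro in_sets_D) (auto simp: concentrated_on_def)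
  have "emeasure D (G \<inter> S) = 0"
  proof (rule null_of_null_on_compactly_contained[OF S_meas])
    fix B assume B: "B \<in> sets borel" "B \<subseteq> G \<inter> S" "B \<subset>\<subset> G"
    have "hausdorff_measure s B \<le> 0"
      using hausdorff_measure_mono[of B S s] B(2) S_null by auto
    then show "emeasure D B = 0" using null B by simp
  qed
  moreover have "emeasure D (space D) = emeasure D (space D \<inter> S)"
    using S sets.top[of D] unfolding concentrated_on_def by blast
  ultimately show False
    using nontrivial by (simp add: space_D)
qed

end

section \<open>Entropy solutions\<close>

lemma norm_Pair_powr_le:
  assumes "0 < r"
  shows "norm (x, y) powr r \<le> 2 powr r * (norm x powr r + norm y powr r)"
proof -
  have "norm (x, y) \<le> norm x + norm y"
    by (rule norm_Pair_le)
  also have "\<dots> \<le> 2 * max (norm x) (norm y)" by simp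
  finally have "norm (x, y) powr r \<le> (2 * max (norm x) (norm y)) powr r"
    using assms by (intro powr_mono2) auto
  also have "\<dots> = 2 powr r * max (norm x) (norm y) powr r"
    by (rule powr_mult)
  also have "\<dots> \<le> 2 powr r * (norm x powr r + norm y powr r)"
    by (intro mult_left_mono) (auto simp: max_def)
  finally show ?thesis .
qed

lemma Lp_loc_Pair:
  fixes f :: "'a::euclidean_space \<Rightarrow> 'b::euclidean_space" and g :: "'a \<Rightarrow> 'c::euclidean_space"
  assumes r: "0 < r" and f: "Lp_loc r G f" and g: "Lp_loc r G g"
  shows "Lp_loc r G (\<lambda>z. (f z, g z))"
  unfolding Lp_loc_def
proof (intro conjI allI impI)
  show meas: "(\<lambda>z. (f z, g z)) \<in> borel_measurable (lebesgue_on G)"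
    using f g by (simp add: Lp_loc_def borel_measurable_Pair)
  fix K assume K: "compact K \<and> K \<subseteq> G"
  show "if r = \<infinity> then \<exists>C. AE z in lebesgue_on K. norm (f z, g z) \<le> C
        else integrable (lebesgue_on K) (\<lambda>z. norm (f z, g z) powr real_of_ereal r)"
  proof (cases "r = \<infinity>")
    case True
    obtain A where A: "AE z in lebesgue_on K. norm (f z) \<le> A"
      using f K True by (auto simp: Lp_loc_def)
    obtain B where B: "AE z in lebesgue_on K. norm (g z) \<le> B"
      using g K True by (auto simp: Lp_loc_def)
    have "AE z in lebesgue_on K. norm (f z, g z) \<le> A + B"
      using A B by eventually_elim (rule order_trans[OF norm_Pair_le add_mono])
    then show ?thesis using True by auto
  next
    case False
    define q where "q = real_of_ereal r"
    have q: "0 < q" using r False by (cases r) (auto simp: q_def)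
    have "integrable (lebesgue_on K) (\<lambda>z. norm (f z) powr q)" "integrable (lebesgue_on K) (\<lambda>z. norm (g z) powr q)"
      using f g K False by (auto simp: Lp_loc_def q_def)
    then have "integrable (lebesgue_on K) (\<lambda>z. 2 powr q * (norm (f z) powr q + norm (g z) powr q))"
      by simp
    moreover have "(\<lambda>z. norm (f z, g z) powr q) \<in> borel_measurable (lebesgue_on K)"
    proof -
      have "(\<lambda>z. (f z, g z)) \<in> borel_measurable (lebesgue_on K)"
        using meas K by (auto intro: measurable_restrict_mono)
      then have "(\<lambda>z. norm (f z, g z)) \<in> borel_measurable (lebesgue_on K)"
        by (rule measurable_compose[OF _ borel_measurable_norm])
      then show ?thesis by simp
    qed
    moreover have "AE z in lebesgue_on K. norm (norm (f z, g z) powr q)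
        \<le> norm (2 powr q * (norm (f z) powr q + norm (g z) powr q))"
      using norm_Pair_powr_le[OF q] by (intro AE_I2) (simp add: abs_of_nonneg)
    ultimately have "integrable (lebesgue_on K) (\<lambda>z. norm (f z, g z) powr q)"
      by (rule Bochner_Integration.integrable_bound)
    then show ?thesis using False by (simp add: q_def)
  qed
qed

theorem theorem1p9:
  fixes \<Omega> :: "(real^'d) set" and T :: real and r :: ereal and s :: real
    and G :: "((real^'d) \<times> real) set"
    and F :: "real^'n \<Rightarrow> real^'n^'d"
    and \<eta> :: "real^'n \<Rightarrow> real" and Q :: "real^'n \<Rightarrow> real^'d"
    and u :: "(real^'d) \<times> real \<Rightarrow> real^'n"
    and D :: "((real^'d) \<times> real) measure"
  assumes r: "ereal ((real CARD('d) + 1) / real CARD('d)) \<le> r"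
    and s: "s = (if r = \<infinity> then real CARD('d)
                 else real CARD('d) + 1 - real_of_ereal r / (real_of_ereal r - 1))"
    and T: "0 < T"
    and \<Omega>: "open \<Omega>" "connected \<Omega>" "\<Omega> \<noteq> {}"
    and G: "G = \<Omega> \<times> {0<..<T}"
    and pair: "entropy_pair G F \<eta> Q"
    and u: "entropy_solution G F \<eta> Q u D"
    and \<eta>_Lr: "Lp_loc r G (\<lambda>z. \<eta> (u z))"
    and Q_Lr: "Lp_loc r G (\<lambda>z. Q (u z))"
  shows "(r < \<infinity> \<longrightarrow>
            (\<forall>B\<in>sets borel. B \<subset>\<subset> G \<longrightarrow> hausdorff_measure s B < \<infinity> \<longrightarrow> emeasure D B = 0)) \<and>
         (r = \<infinity> \<longrightarrow>
            (\<forall>A\<in>sets D. hausdorff_measure (real CARD('d)) A = 0 \<longrightarrow> emeasure D A = 0)) \<and>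
         (emeasure D (space D) \<noteq> 0 \<longrightarrow>
            (\<forall>S. concentrated_on D S \<longrightarrow> ereal s \<le> hausdorff_dim S))"
proof -
  define n where "n = real CARD('d)"
  have n: "0 < n" by (simp add: n_def)
  interpret dissipative_field G "entropy_field \<eta> Q u" D
    using u \<Omega>(1) by unfold_locales (auto simp: entropy_solution_def G intro!: open_Times)
  have dim: "real DIM((real^'d) \<times> real) = n + 1"
    by (simp add: n_def)
  have "0 < ereal ((n + 1) / n)" using n by simp
  then have "0 < r" using r unfolding n_def by (rule less_le_trans)
  then have V: "Lp_loc r G (entropy_field \<eta> Q u)"
    unfolding entropy_field_def by (intro Lp_loc_Pair Q_Lr \<eta>_Lr)
  have finite_case: "emeasure D B = 0"
    if "r < \<infinity>" "B \<in> sets borel" "B \<subset>\<subset> G" "hausdorff_measure s B < \<infinity>" for B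
  proof -
    obtain q where q: "r = ereal q"
      using \<open>0 < r\<close> \<open>r < \<infinity>\<close> by (cases r) auto
    \<comment> \<open>The lower bound on \<open>r\<close> is equivalent to \<open>s \<ge> 0\<close>.\<close>
    have q_ge: "(n + 1) / n \<le> q" using r by (simp add: q n_def)
    moreover have "1 < (n + 1) / n" using n by simp
    ultimately have q1: "1 < q" by linarith
    have "s = real DIM((real^'d) \<times> real) - q / (q - 1)"
      unfolding dim using s by (simp add: q n_def)
    moreover have "q / (q - 1) \<le> n + 1"
      using q_ge q1 n by (simp add: divide_simps algebra_simps)
    ultimately show ?thesis
      using V q q1 that by (intro null_of_hausdorff_finite[of q s]) (auto simp: dim n_def)
  qed
  have bounded_case: "emeasure D A = 0"
    if "r = \<infinity>" "A \<in> sets D" "hausdorff_measure (real CARD('d)) A = 0" for A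
    using V that by (intro null_of_hausdorff_null_bounded) (auto simp: dim n_def)
  have "emeasure D B = 0" if B: "B \<in> sets borel" "B \<subset>\<subset> G" "hausdorff_measure s B = 0" for B
  proof (cases "r = \<infinity>")
    case True
    have "B \<subseteq> G" using B(2) closure_subset unfolding compactly_contained_def by blast
    then have "B \<in> sets D" using B(1) in_sets_D by blast
    then show ?thesis using bounded_case True B(3) s by simp
  qed (use B in \<open>auto intro: finite_case\<close>)
  then have "ereal s \<le> hausdorff_dim S" if "emeasure D (space D) \<noteq> 0" "concentrated_on D S" for S
    using that by (rule dimension_of_concentration_set)
  then show ?thesis
    using finite_case bounded_case by blast
qed

end
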